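(* Consider a channel with action-dependent state known causally at the encoder, with finite action alphabet $\mathcal{B}$, state alphabet $\mathcal{S}$, input alphabet $\mathcal{X}$ and output alphabet $\mathcal{Y}$, regarded as a channel with in-block memory of block length $L=2$ (so that its capacity $C$ is normalized per slot, two slots per block). Then $$2C=\max_{P_{B\mathbf{A}_2}}I(B\mathbf{A}_2;Y),$$ where $B\in\mathcal{B}$, $\mathbf{A}_2$ is a function from $\mathcal{S}$ to $\mathcal{X}$, and $X=\mathbf{A}_2(S)$; and the maximum is attained by a $P_{B\mathbf{A}_2}$ with $$|\mathrm{supp}(P_{B\mathbf{A}_2})|\le\min\left(|\mathcal{Y}|,\ |\mathcal{B}|+|\mathcal{B}|\,|\mathcal{S}|\,(|\mathcal{X}|-1)\right).$$
   Context: Model. Message $W$ is uniformly distributed. In block $i$, the encoder chooses an action $B_i$ as a function of $W$ and $S^{i-1}$; the state is $S_i=g(B_i,Z_i)$; the encoder then chooses $X_i$ as a function of $W$ and $S^i$; the channel output is $Y_i=f(X_i,S_i,Z_i)$. Here $f,g$ are fixed functions and $Z_1,Z_2,\dots$ are i.i.d. noise variables (possibly vectors, possibly influencing both $S_i$ and $Y_i$), independent of $W$. The receiver decodes $W$ from the outputs $Y_1,Y_2,\dots$. $2C$ is the supremum of rates in bits per block $i$ for which the error probability can be made arbitrarily small. In the single-block formula, $(B,\mathbf{A}_2)$ is independent of $Z$, $S=g(B,Z)$, $X=\mathbf{A}_2(S)$, $Y=f(X,S,Z)$. $\mathrm{supp}(P)$ is the support of $P$. *)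

theory Defs
  imports "HOL-Probability.Probability"
begin

text \<open>
  A channel with action-dependent state is given by the state map \<open>g\<close> (\<open>S = g B Z\<close>), the
  output map \<open>f\<close> (\<open>Y = f X S Z\<close>) and the law \<open>N\<close> of the noise \<open>Z\<close>, which lives on an arbitrary
  probability space. The alphabets are finite types; the set of noise values is unrestricted.

  In a code with \<open>M\<close> messages \<open>{..<M}\<close> the encoder consists of \<open>act\<close> and \<open>inp\<close>: the action in a
  block is \<open>act w ss\<close> where \<open>ss\<close> lists the states of all earlier blocks, and the channel input is
  \<open>inp w ss\<close> where \<open>ss\<close> additionally ends with the state of the current block. The block index
  needs no separate argument because it is determined by the length of \<open>ss\<close>. Blocks are numbered
  from 0.
\<close>

primrec state_seq ::
  "('b \<Rightarrow> 'z \<Rightarrow> 's) \<Rightarrow> (nat \<Rightarrow> 's list \<Rightarrow> 'b) \<Rightarrow> nat \<Rightarrow> (nat \<Rightarrow> 'z) \<Rightarrow> nat \<Rightarrow> 's list"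
where
  "state_seq g act w z 0 = []"
| "state_seq g act w z (Suc i) =
     (let ss = state_seq g act w z i in ss @ [g (act w ss) (z i)])"

definition block_output ::
  "('x \<Rightarrow> 's \<Rightarrow> 'z \<Rightarrow> 'y) \<Rightarrow> ('b \<Rightarrow> 'z \<Rightarrow> 's) \<Rightarrow> (nat \<Rightarrow> 's list \<Rightarrow> 'b) \<Rightarrow> (nat \<Rightarrow> 's list \<Rightarrow> 'x)
    \<Rightarrow> nat \<Rightarrow> (nat \<Rightarrow> 'z) \<Rightarrow> nat \<Rightarrow> 'y"
where
  "block_output f g act inp w z i =
     (let ss = state_seq g act w z (Suc i) in f (inp w ss) (last ss) (z i))"

definition error_prob ::
  "'z measure \<Rightarrow> ('x \<Rightarrow> 's \<Rightarrow> 'z \<Rightarrow> 'y) \<Rightarrow> ('b \<Rightarrow> 'z \<Rightarrow> 's) \<Rightarrow> nat \<Rightarrow> nat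
    \<Rightarrow> (nat \<Rightarrow> 's list \<Rightarrow> 'b) \<Rightarrow> (nat \<Rightarrow> 's list \<Rightarrow> 'x) \<Rightarrow> ('y list \<Rightarrow> nat) \<Rightarrow> real"
where
  "error_prob N f g M n act inp dec =
     (let \<Omega> = measure_pmf (pmf_of_set {..<M}) \<Otimes>\<^sub>M (\<Pi>\<^sub>M i\<in>{..<n}. N)
      in measure \<Omega> {(w, z) \<in> space \<Omega>. dec (map (block_output f g act inp w z) [0..<n]) \<noteq> w})"

text \<open>Rates are in bits per block.\<close>

definition achievable_rate ::
  "'z measure \<Rightarrow> ('x \<Rightarrow> 's \<Rightarrow> 'z \<Rightarrow> 'y) \<Rightarrow> ('b \<Rightarrow> 'z \<Rightarrow> 's) \<Rightarrow> real \<Rightarrow> bool"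
where
  "achievable_rate N f g R \<longleftrightarrow>
     (\<forall>\<epsilon>>0. \<exists>n>0. \<exists>M>0. R \<le> log 2 (real M) / real n \<and>
        (\<exists>act inp dec. error_prob N f g M n act inp dec < \<epsilon>))"

text \<open>
  Each block consists of two slots (the choice of the action and the use of the channel proper),
  and the capacity is normalized per slot. It is an extended real so that the supremum is
  meaningful without first knowing that the achievable rates are bounded.
\<close>

definition slots_per_block :: nat where
  "slots_per_block = 2"

definition capacity ::
  "'z measure \<Rightarrow> ('x \<Rightarrow> 's \<Rightarrow> 'z \<Rightarrow> 'y) \<Rightarrow> ('b \<Rightarrow> 'z \<Rightarrow> 's) \<Rightarrow> ereal"
where
  "capacity N f g =
     (SUP R\<in>{R. achievable_rate N f g R}. ereal R) / ereal (real slots_per_block)"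

text \<open>
  \<open>I(B A; Y)\<close> in bits, where the pair of the action \<open>B\<close> and the map \<open>A\<close> from states to inputs has
  law \<open>P\<close> and is independent of \<open>Z\<close>, and \<open>S = g B Z\<close>, \<open>X = A S\<close>, \<open>Y = f X S Z\<close>.
\<close>

definition single_block_output ::
  "('x \<Rightarrow> 's \<Rightarrow> 'z \<Rightarrow> 'y) \<Rightarrow> ('b \<Rightarrow> 'z \<Rightarrow> 's) \<Rightarrow> ('b \<times> ('s \<Rightarrow> 'x)) \<times> 'z \<Rightarrow> 'y"
where
  "single_block_output f g = (\<lambda>((b, a), z). let s = g b z in f (a s) s z)"

definition block_information ::
  "'z measure \<Rightarrow> ('x \<Rightarrow> 's \<Rightarrow> 'z \<Rightarrow> 'y) \<Rightarrow> ('b \<Rightarrow> 'z \<Rightarrow> 's) \<Rightarrow> ('b \<times> ('s \<Rightarrow> 'x)) pmf \<Rightarrow> real"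
where
  "block_information N f g P =
     prob_space.mutual_information (measure_pmf P \<Otimes>\<^sub>M N) 2 (count_space UNIV) (count_space UNIV)
       fst (single_block_output f g)"

end

theory Submission
  imports Defs
begin

text \<open>
  In each block the encoder effectively feeds the pair \<open>u = (b, a)\<close> into a memoryless channel
  \<open>W(y | u)\<close> with finite alphabets. Choosing the pairs as a function of the message alone, Feinstein's
  greedy construction with a Chernoff bound for the information density attains every rate below
  \<open>C = max I(U; Y)\<close>.

  Conversely, if \<open>q\<close> is the output law of an optimal input, then \<open>D(W u || q) \<le> C\<close> for every \<open>u\<close>, hence
  \<open>\<Sum>\<^sub>y W u y ln (v y) \<le> C + ln (\<Sum>\<^sub>y q y v y)\<close> for every positive \<open>v\<close>. As \<open>u\<close> in a block is determined by the
  message and the past states, which are independent of the noise of the block, this inequality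
  tensorizes over the blocks although the encoder uses the states.

  An optimal input of minimal support has linearly independent rows \<open>W u\<close>, so its support is
  bounded by the length of any factorization \<open>W u y = \<Sum>\<^sub>k \<phi> k u * \<psi> k y\<close>. Logarithms are natural
  until the comparison with \<open>block_information\<close>.
\<close>

subsection \<open>Linear relations and words\<close>

text \<open>Gaussian elimination by induction on the equations \<open>K\<close>: one that vanishes
  on \<open>U\<close> is dropped, otherwise it is solved for a pivot unknown
  \<open>u0\<close>.\<close>

lemma ex_nontrivial_relation:
  fixes \<phi> :: "'k \<Rightarrow> 'u \<Rightarrow> real"
  assumes "finite K" "finite U" "card K < card U"
  shows "\<exists>c. (\<exists>u\<in>U. c u \<noteq> 0) \<and> (\<forall>k\<in>K. (\<Sum>u\<in>U. c u * \<phi> k u) = 0)"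
  using assms
proof (induction K arbitrary: U \<phi> rule: finite_induct)
  case empty
  then have "U \<noteq> {}" by auto
  then show ?case by (intro exI[of _ "\<lambda>_. 1"]) auto
next
  case (insert k K)
  show ?case
  proof (cases "\<forall>u\<in>U. \<phi> k u = 0")
    case True
    from insert have "card K < card U" by simp
    from insert.IH[OF insert.prems(1) this, of \<phi>] obtain c where
      "\<exists>u\<in>U. c u \<noteq> 0" "\<forall>k\<in>K. (\<Sum>u\<in>U. c u * \<phi> k u) = 0" by blast
    then show ?thesis using True by (intro exI[of _ c]) auto
  next
    case False
    then obtain u0 where u0: "u0 \<in> U" "\<phi> k u0 \<noteq> 0" by blast
    define V where "V = U - {u0}"
    have V: "finite V" "card K < card V" "u0 \<notin> V" and U: "U = insert u0 V"
      using insert u0 by (auto simp: V_def)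
    obtain c where c: "\<exists>u\<in>V. c u \<noteq> 0"
      "\<And>j. j \<in> K \<Longrightarrow> (\<Sum>u\<in>V. c u * (\<phi> j u - \<phi> j u0 * \<phi> k u / \<phi> k u0)) = 0"
      using insert.IH[OF V(1,2), of "\<lambda>j u. \<phi> j u - \<phi> j u0 * \<phi> k u / \<phi> k u0"] by blast
    \<comment> \<open>The value at \<open>u0\<close> solves equation \<open>k\<close>; the reduced
      coefficients come from substituting it into the other equations.\<close>
    define d where "d = c(u0 := - (\<Sum>u\<in>V. c u * \<phi> k u) / \<phi> k u0)"
    have d: "(\<Sum>u\<in>U. d u * \<phi> j u)
        = (\<Sum>u\<in>V. c u * \<phi> j u) - (\<Sum>u\<in>V. c u * \<phi> k u) / \<phi> k u0 * \<phi> j u0" for j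
    proof -
      have "(\<Sum>u\<in>V. d u * \<phi> j u) = (\<Sum>u\<in>V. c u * \<phi> j u)"
        using V(3) by (intro sum.cong) (auto simp: d_def)
      then show ?thesis using V by (simp add: U) (simp add: d_def)
    qed
    have "(\<Sum>u\<in>U. d u * \<phi> j u) = 0" if "j \<in> insert k K" for j
    proof (cases "j = k")
      case True
      then show ?thesis using u0 by (simp add: d)
    next
      case False
      then have "(\<Sum>u\<in>V. c u * (\<phi> j u - \<phi> j u0 * \<phi> k u / \<phi> k u0)) = 0"
        using that c(2) by blast
      then show ?thesis
        by (simp add: d algebra_simps sum_subtractf sum_distrib_left sum_divide_distrib)
    qed
    moreover have "\<exists>u\<in>U. d u \<noteq> 0" using c(1) V(3) by (auto simp: d_def U)
    ultimately show ?thesis by blast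
  qed
qed

section \<open>Sums over words of fixed length\<close>

abbreviation words :: "nat \<Rightarrow> 'a list set" where
  "words n \<equiv> {xs. length xs = n}"

lemma finite_words [simp]: "finite (words n :: 'a::finite list set)"
  using finite_lists_length_eq[of "UNIV :: 'a set" n] by simp

lemma sum_words_Suc:
  fixes F :: "'a::finite list \<Rightarrow> real"
  shows "(\<Sum>xs\<in>words (Suc n). F xs) = (\<Sum>xs\<in>words n. \<Sum>x\<in>UNIV. F (xs @ [x]))"
proof -
  have "(\<Sum>xs\<in>words (Suc n). F xs) = (\<Sum>(xs, x)\<in>words n \<times> UNIV. F (xs @ [x]))"
    by (rule sum.reindex_bij_witness[of _ "\<lambda>(xs, x). xs @ [x]" "\<lambda>xs. (butlast xs, last xs)"])
       (auto simp: length_Suc_conv_rev)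
  then show ?thesis by (simp add: sum.cartesian_product)
qed

text \<open>Distributivity. The factors may depend on the position, so that one of two words can be
  held fixed.\<close>

lemma sum_words_prod:
  fixes h :: "nat \<Rightarrow> 'a::finite \<Rightarrow> real"
  shows "(\<Sum>xs\<in>words n. \<Prod>i<n. h i (xs ! i)) = (\<Prod>i<n. \<Sum>x\<in>UNIV. h i x)"
proof (induction n)
  case (Suc n)
  have "(\<Sum>xs\<in>words (Suc n). \<Prod>i<Suc n. h i (xs ! i))
      = (\<Sum>xs\<in>words n. \<Sum>x\<in>UNIV. (\<Prod>i<n. h i (xs ! i)) * h n x)"
    unfolding sum_words_Suc by (intro sum.cong) (auto simp: nth_append)
  then show ?case by (simp add: Suc[symmetric] sum_product)
qed simp

subsection \<open>Mutual information of a finite channel\<close>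

definition is_dist :: "('u::finite \<Rightarrow> real) \<Rightarrow> bool" where
  "is_dist P \<longleftrightarrow> (\<forall>u. 0 \<le> P u) \<and> sum P UNIV = 1"

definition eta :: "real \<Rightarrow> real" where
  "eta x = - x * ln x"

text \<open>Continuity at 0 matters because output probabilities may vanish on the boundary of the
  simplex.\<close>

lemma continuous_on_eta: "continuous_on {0..} eta"
proof -
  have "continuous (at x within {0..}) eta" if "x \<ge> 0" for x
  proof (cases "x = 0")
    case True
    have "((\<lambda>x. - x * ln x) \<longlongrightarrow> 0) (at_right (0::real))" by real_asymp
    then show ?thesis
      using True by (simp add: continuous_within eta_def[abs_def] at_within_Ici_at_right)
  next
    case False
    then show ?thesis using that unfolding eta_def[abs_def]
      by (intro continuous_intros) auto
  qed
  then show ?thesis by (simp add: continuous_on_eq_continuous_within)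
qed

lemma compact_dists: "compact {p :: real ^ 'u::finite. is_dist (($) p)}"
proof (rule compact_eq_bounded_closed[THEN iffD2, OF conjI])
  show "bounded {p :: real ^ 'u. is_dist (($) p)}"
  proof (rule boundedI[of _ 1])
    fix p :: "real ^ 'u" assume "p \<in> {p. is_dist (($) p)}"
    then show "norm p \<le> 1"
      using norm_le_l1_cart[of p] by (simp add: is_dist_def)
  qed
  show "closed {p :: real ^ 'u. is_dist (($) p)}"
    unfolding is_dist_def
    by (intro closed_Collect_conj closed_Collect_all closed_Collect_le closed_Collect_eq continuous_intros)
qed

locale finite_channel =
  fixes W :: "'u::finite \<Rightarrow> 'y::finite \<Rightarrow> real"
  assumes W_nonneg: "0 \<le> W u y"
    and W_sum: "(\<Sum>y\<in>UNIV. W u y) = 1"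
begin

definition out :: "('u \<Rightarrow> real) \<Rightarrow> 'y \<Rightarrow> real" where
  "out P y = (\<Sum>u\<in>UNIV. P u * W u y)"

text \<open>The conditional entropy H(Y | U = u) in nats.\<close>

definition ent :: "'u \<Rightarrow> real" where
  "ent u = (\<Sum>y\<in>UNIV. eta (W u y))"

text \<open>I(U; Y) as H(Y) - H(Y | U). This form is continuous on the whole simplex, and affine in
  directions that preserve the output law.\<close>

definition info :: "('u \<Rightarrow> real) \<Rightarrow> real" where
  "info P = (\<Sum>y\<in>UNIV. eta (out P y)) - (\<Sum>u\<in>UNIV. P u * ent u)"

lemma is_dist_out: "is_dist P \<Longrightarrow> is_dist (out P)"
proof -
  assume P: "is_dist P"
  have "(\<Sum>y\<in>UNIV. out P y) = (\<Sum>u\<in>UNIV. P u * (\<Sum>y\<in>UNIV. W u y))"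
    unfolding out_def by (subst sum.swap) (simp add: sum_distrib_left)
  then show ?thesis using P W_nonneg
    by (auto simp: is_dist_def W_sum out_def intro!: sum_nonneg)
qed

lemma out_pos: "is_dist P \<Longrightarrow> P u > 0 \<Longrightarrow> W u y > 0 \<Longrightarrow> out P y > 0"
  unfolding out_def is_dist_def using W_nonneg
  by (intro sum_pos2[of _ u]) auto

text \<open>Cells with \<open>P u * W u y = 0\<close> contribute nothing; in all others the output
  has positive probability and the logarithm splits.\<close>

lemma info_eq_sum_ln:
  assumes "is_dist P"
  shows "info P = (\<Sum>u\<in>UNIV. \<Sum>y\<in>UNIV. P u * W u y * ln (W u y / out P y))"
proof -
  have *: "P u * W u y * ln (W u y / out P y)
      = P u * W u y * ln (W u y) - P u * W u y * ln (out P y)" for u y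
  proof (cases "P u = 0 \<or> W u y = 0")
    case False
    then have "P u > 0" "W u y > 0" using assms W_nonneg by (auto simp: is_dist_def less_le)
    then show ?thesis using out_pos[OF assms, of u y] by (simp add: ln_div algebra_simps)
  qed auto
  have "(\<Sum>u\<in>UNIV. \<Sum>y\<in>UNIV. P u * W u y * ln (out P y)) = (\<Sum>y\<in>UNIV. out P y * ln (out P y))"
    by (subst sum.swap) (simp add: out_def sum_distrib_right)
  moreover have "(\<Sum>u\<in>UNIV. \<Sum>y\<in>UNIV. P u * W u y * ln (W u y)) = - (\<Sum>u\<in>UNIV. P u * ent u)"
    by (simp add: ent_def eta_def sum_negf sum_distrib_left mult.assoc)
  ultimately show ?thesis
    by (simp only: * sum_subtractf info_def) (simp add: eta_def sum_negf)
qed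

lemma ex_max_info:
  "\<exists>P. is_dist P \<and> (\<forall>Q. is_dist Q \<longrightarrow> info Q \<le> info P)"
proof -
  let ?S = "{p :: real ^ 'u. is_dist (($) p)}"
  have "(\<chi> u. 1 / CARD('u)) \<in> ?S" by (simp add: is_dist_def)
  then have "?S \<noteq> {}" by blast
  moreover have "continuous_on ?S (\<lambda>p. info (($) p))"
    unfolding info_def
  proof (intro continuous_intros continuous_on_compose2[OF continuous_on_eta])
    show "continuous_on ?S (\<lambda>p. out (($) p) y)" for y
      unfolding out_def by (intro continuous_intros)
    show "(\<lambda>p. out (($) p) y) ` ?S \<subseteq> {0..}" for y
      using is_dist_out by (auto simp: is_dist_def)
  qed
  ultimately obtain p where p: "p \<in> ?S" "\<And>q. q \<in> ?S \<Longrightarrow> info (($) q) \<le> info (($) p)"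
    using continuous_attains_sup[OF compact_dists] by metis
  have "info Q \<le> info (($) p)" if "is_dist Q" for Q
    using p(2)[of "\<chi> u. Q u"] that by (simp add: vec_lambda_inverse)
  then show ?thesis using p by auto
qed


lemma info_add_kernel:
  assumes "\<And>y. (\<Sum>u\<in>UNIV. c u * W u y) = 0"
  shows "info (\<lambda>u. P u + t * c u) = info P - t * (\<Sum>u\<in>UNIV. c u * ent u)"
proof -
  have "out (\<lambda>u. P u + t * c u) = out P"
  proof
    fix y
    have "out (\<lambda>u. P u + t * c u) y = out P y + t * (\<Sum>u\<in>UNIV. c u * W u y)"
      by (simp add: out_def algebra_simps sum.distrib sum_distrib_left)
    then show "out (\<lambda>u. P u + t * c u) y = out P y" by (simp add: assms)
  qed
  then show ?thesis
    by (simp add: info_def algebra_simps sum.distrib sum_distrib_left)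
qed

text \<open>
  A linear relation \<open>c\<close> between the rows of \<open>W\<close> in the support of \<open>P\<close> has total weight 0, and
  moving \<open>P\<close> along \<open>c\<close> does not change the output law, so that \<open>info\<close> is affine in this direction.
  With the sign of \<open>c\<close> that makes \<open>info\<close> nondecreasing, one walks until a mass vanishes.
\<close>

lemma info_reduce_support:
  assumes P: "is_dist P" and K: "finite K" "card K < card {u. P u \<noteq> 0}"
    and W: "\<And>u y. W u y = (\<Sum>k\<in>K. \<phi> k u * \<psi> k y)"
  shows "\<exists>P'. is_dist P' \<and> info P \<le> info P' \<and> card {u. P' u \<noteq> 0} < card {u. P u \<noteq> 0}"
proof -
  let ?S = "{u. P u \<noteq> 0}"
  obtain c0 where c0: "\<exists>u\<in>?S. c0 u \<noteq> 0" "\<forall>k\<in>K. (\<Sum>u\<in>?S. c0 u * \<phi> k u) = 0"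
    using ex_nontrivial_relation[of K ?S \<phi>] K by auto
  define c where "c u = (if P u = 0 then 0 else if (\<Sum>u\<in>?S. c0 u * ent u) \<le> 0 then c0 u else - c0 u)" for u
  have c_sum: "(\<Sum>u\<in>UNIV. c u * h u) = (if (\<Sum>u\<in>?S. c0 u * ent u) \<le> 0 then 1 else -1) * (\<Sum>u\<in>?S. c0 u * h u)"
    for h :: "'u \<Rightarrow> real"
  proof -
    have "(\<Sum>u\<in>UNIV. c u * h u) = (\<Sum>u\<in>?S. c u * h u)"
      by (rule sum.mono_neutral_right) (auto simp: c_def)
    then show ?thesis by (simp add: c_def sum_negf)
  qed
  have c_W: "(\<Sum>u\<in>UNIV. c u * W u y) = 0" for y
  proof -
    have "(\<Sum>u\<in>?S. c0 u * W u y) = (\<Sum>k\<in>K. (\<Sum>u\<in>?S. c0 u * \<phi> k u) * \<psi> k y)"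
      unfolding W sum_distrib_left sum_distrib_right by (subst sum.swap) (simp add: mult_ac)
    then show ?thesis using c0(2) by (simp add: c_sum)
  qed
  have c_ent: "(\<Sum>u\<in>UNIV. c u * ent u) \<le> 0" by (simp add: c_sum)
  have c_nz: "\<exists>u. c u \<noteq> 0" using c0(1) by (auto simp: c_def)
  \<comment> \<open>Each row of \<open>W\<close> sums to 1, so a relation between rows has total
    weight 0.\<close>
  have c_total: "sum c UNIV = 0"
  proof -
    have "sum c UNIV = (\<Sum>u\<in>UNIV. c u * (\<Sum>y\<in>UNIV. W u y))" by (simp add: W_sum)
    also have "\<dots> = (\<Sum>y\<in>UNIV. \<Sum>u\<in>UNIV. c u * W u y)"
      unfolding sum_distrib_left by (rule sum.swap)
    finally show ?thesis by (simp add: c_W)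
  qed
  let ?N = "{u. c u < 0}"
  have N: "?N \<noteq> {}"
  proof
    assume "?N = {}"
    then have "\<forall>u. 0 \<le> c u" by (auto simp: not_less)
    then show False using c_total c_nz by (simp add: sum_nonneg_eq_0_iff)
  qed
  \<comment> \<open>The longest step that keeps every mass nonnegative; a minimizer \<open>v\<close>
    loses all its mass.\<close>
  define t where "t = Min ((\<lambda>u. P u / - c u) ` ?N)"
  have t_le: "t \<le> P u / - c u" if "c u < 0" for u
    unfolding t_def using that by (intro Min_le) auto
  have "t \<in> (\<lambda>u. P u / - c u) ` ?N"
    unfolding t_def using N by (intro Min_in) auto
  then obtain v where v: "c v < 0" "t = P v / - c v" by auto
  have P_nonneg: "0 \<le> P u" for u using P by (simp add: is_dist_def)
  have t: "0 \<le> t" unfolding v(2) using v(1) P_nonneg[of v] by (intro divide_nonneg_nonneg) auto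
  let ?P' = "\<lambda>u. P u + t * c u"
  have "is_dist ?P'"
    unfolding is_dist_def
  proof (intro conjI allI)
    fix u show "0 \<le> ?P' u"
    proof (cases "c u < 0")
      case True
      then have "t * - c u \<le> P u" using t_le[OF True] by (simp add: pos_le_divide_eq del: divide_minus_right)
      then show ?thesis by simp
    next
      case False
      then show ?thesis using t P_nonneg by simp
    qed
    show "sum ?P' UNIV = 1"
      using P c_total by (simp add: sum.distrib is_dist_def sum_distrib_left[symmetric])
  qed
  moreover have "info P \<le> info ?P'"
    using c_ent t by (simp add: info_add_kernel[OF c_W] mult_nonneg_nonpos)
  moreover have "{u. ?P' u \<noteq> 0} \<subset> ?S"
  proof
    show "{u. ?P' u \<noteq> 0} \<subseteq> ?S" by (auto simp: c_def)
    have "v \<in> ?S" "?P' v = 0" using v by (auto simp: c_def split: if_splits)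
    then show "{u. ?P' u \<noteq> 0} \<noteq> ?S" by blast
  qed
  then have "card {u. ?P' u \<noteq> 0} < card ?S" by (intro psubset_card_mono) auto
  ultimately show ?thesis by blast
qed

section \<open>Optimal inputs: support size and Kuhn-Tucker condition\<close>

definition optimal :: "('u \<Rightarrow> real) \<Rightarrow> bool" where
  "optimal P \<longleftrightarrow> is_dist P \<and> (\<forall>Q. is_dist Q \<longrightarrow> info Q \<le> info P)"

lemma ex_optimal_min_support:
  "\<exists>P. optimal P \<and> (\<forall>Q. optimal Q \<longrightarrow> card {u. P u \<noteq> 0} \<le> card {u. Q u \<noteq> 0})"
  using ex_max_info ex_has_least_nat[of optimal _ "\<lambda>P. card {u. P u \<noteq> 0}"]
  unfolding optimal_def by metis

text \<open>Otherwise \<open>info_reduce_support\<close> gives an optimal input of smaller support.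
  Both cardinality bounds arise from this lemma by different factorizations.\<close>

lemma min_support_le:
  assumes P: "optimal P" and P_min: "\<And>Q. optimal Q \<Longrightarrow> card {u. P u \<noteq> 0} \<le> card {u. Q u \<noteq> 0}"
    and "finite K" "\<And>u y. W u y = (\<Sum>k\<in>K. \<phi> k u * \<psi> k y)"
  shows "card {u. P u \<noteq> 0} \<le> card K"
proof (rule ccontr)
  assume "\<not> ?thesis"
  then obtain P' where P': "is_dist P'" "info P \<le> info P'" "card {u. P' u \<noteq> 0} < card {u. P u \<noteq> 0}"
    using info_reduce_support[OF _ assms(3) _ assms(4), of P] P by (auto simp: optimal_def not_le)
  then have "optimal P'" using P order_trans unfolding optimal_def by blast
  then show False using P_min[of P'] P'(3) by simp
qed

text \<open>
  This is what optimality of \<open>P\<close> gives for the input law \<open>(1 - t) P + t \<delta>\<^sub>u\<close>. The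
  limit \<open>t \<rightarrow> 0\<close> is the Kuhn-Tucker condition; no derivative is taken, so that outputs of
  probability 0 under \<open>P\<close> are covered too.
\<close>

lemma sum_ln_out_mix_le:
  assumes P: "optimal P"
    and t: "0 < t" "t < 1"
  shows "(\<Sum>y\<in>UNIV. - W u y * ln ((1 - t) * out P y + t * W u y)) \<le> info P + ent u"
proof -
  define q where "q y = (1 - t) * out P y + t * W u y" for y
  define Q where "Q v = (1 - t) * P v + (if v = u then t else 0)" for v
  have dist: "is_dist P" using P by (simp add: optimal_def)
  have Q: "is_dist Q" using dist t by (simp add: is_dist_def Q_def sum.distrib sum_distrib_left[symmetric])
  have Q_sum: "(\<Sum>v\<in>UNIV. Q v * h v) = (1 - t) * (\<Sum>v\<in>UNIV. P v * h v) + t * h u" for h :: "'u \<Rightarrow> real"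
    by (simp add: Q_def distrib_right sum.distrib sum_distrib_left mult.assoc if_distrib[of "\<lambda>x. x * _"] cong: if_cong)
  have outQ: "out Q y = q y" for y by (simp add: out_def Q_sum q_def)
  have P_out: "0 \<le> out P y" "(\<Sum>y\<in>UNIV. out P y) = 1" for y
    using is_dist_out P by (auto simp: is_dist_def optimal_def)
  have q: "(\<Sum>y\<in>UNIV. q y) = 1" using is_dist_out[OF Q] by (simp add: is_dist_def outQ)
  \<comment> \<open>Gibbs' inequality, by ln x <= x - 1 in each cell.\<close>
  have gibbs: "(\<Sum>y\<in>UNIV. eta (out P y)) \<le> (\<Sum>y\<in>UNIV. - out P y * ln (q y))"
  proof -
    have "out P y * ln (q y) + eta (out P y) \<le> q y - out P y" for y
    proof (cases "out P y = 0")
      case True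
      then show ?thesis using t W_nonneg by (simp add: eta_def q_def)
    next
      case False
      then have o: "out P y > 0" using P_out(1)[of y] by simp
      then have qy: "q y > 0" unfolding q_def using t W_nonneg by (intro add_pos_nonneg) auto
      have "out P y * ln (q y) + eta (out P y) = out P y * ln (q y / out P y)"
        using o qy by (simp add: eta_def ln_div algebra_simps)
      also have "\<dots> \<le> out P y * (q y / out P y - 1)"
        using o qy by (intro mult_left_mono ln_le_minus_one) auto
      finally show ?thesis using o by (simp add: algebra_simps)
    qed
    then have "(\<Sum>y\<in>UNIV. out P y * ln (q y) + eta (out P y)) \<le> (\<Sum>y\<in>UNIV. q y - out P y)"
      by (rule sum_mono)
    then show ?thesis using q P_out(2) by (simp add: sum.distrib sum_subtractf sum_negf)
  qed
  \<comment> \<open>By \<open>gibbs\<close>, \<open>info Q\<close> is at least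
    \<open>(1 - t) * info P\<close> plus t times the cross entropy of \<open>W u\<close> and
    \<open>q\<close> minus \<open>ent u\<close>. Comparing with \<open>info P\<close> leaves a
    multiple of t.\<close>
  have "info Q \<le> info P" using P Q by (auto simp: optimal_def)
  moreover have "info Q = (1 - t) * (\<Sum>y\<in>UNIV. - out P y * ln (q y)) + t * (\<Sum>y\<in>UNIV. - W u y * ln (q y))
      - ((1 - t) * (\<Sum>v\<in>UNIV. P v * ent v) + t * ent u)"
  proof -
    have "(\<Sum>y\<in>UNIV. eta (q y)) = (1 - t) * (\<Sum>y\<in>UNIV. - out P y * ln (q y)) + t * (\<Sum>y\<in>UNIV. - W u y * ln (q y))"
      unfolding sum_distrib_left sum.distrib[symmetric]
      by (intro sum.cong) (auto simp: eta_def q_def algebra_simps)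
    then show ?thesis by (simp add: info_def[of Q] outQ Q_sum)
  qed
  moreover have "(1 - t) * (\<Sum>y\<in>UNIV. eta (out P y)) \<le> (1 - t) * (\<Sum>y\<in>UNIV. - out P y * ln (q y))"
    using gibbs t by (intro mult_left_mono) auto
  moreover have "t * info P = t * (\<Sum>y\<in>UNIV. eta (out P y)) - t * (\<Sum>v\<in>UNIV. P v * ent v)"
    by (simp add: info_def right_diff_distrib)
  ultimately have "t * (\<Sum>y\<in>UNIV. - W u y * ln (q y)) \<le> t * (info P + ent u)"
    unfolding info_def[of P] by (simp add: algebra_simps)
  then show ?thesis using t by (simp add: q_def)
qed

text \<open>If \<open>out P y = 0\<close>, the summand at y in \<open>sum_ln_out_mix_le\<close> is
  \<open>- W u y * ln (t * W u y)\<close>, which is unbounded as t tends to 0.\<close>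

lemma max_info_out_pos:
  assumes P: "optimal P"
    and "W u y > 0"
  shows "out P y > 0"
proof (rule ccontr)
  assume "\<not> out P y > 0"
  then have y: "out P y = 0" using is_dist_out[of P] P by (auto simp: is_dist_def optimal_def not_less intro: antisym)
  have le: "- W u y * ln (t * W u y) \<le> info P + ent u" if t: "0 < t" "t < 1" for t
  proof -
    let ?q = "\<lambda>y. (1 - t) * out P y + t * W u y"
    have "0 \<le> - W u z * ln (?q z)" for z
    proof -
      have "out P z \<le> 1" "W u z \<le> 1" "0 \<le> out P z"
        using is_dist_out[of P] P member_le_sum[of z UNIV "out P"] member_le_sum[of z UNIV "W u"] W_sum[of u] W_nonneg
        by (auto simp: is_dist_def optimal_def)
      then have "?q z \<le> 1" using t convex_bound_le[of "out P z" 1 "W u z" "1 - t" t] by simp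
      moreover have "0 \<le> ?q z" using t \<open>0 \<le> out P z\<close> W_nonneg by simp
      ultimately have "ln (?q z) \<le> 0" by (cases "?q z = 0") auto
      then show ?thesis using W_nonneg by (simp add: mult_nonneg_nonpos)
    qed
    then have "- W u y * ln (?q y) \<le> (\<Sum>z\<in>UNIV. - W u z * ln (?q z))"
      by (intro member_le_sum) auto
    also have "\<dots> \<le> info P + ent u" by (rule sum_ln_out_mix_le[OF P t])
    finally show ?thesis by (simp add: y)
  qed
  \<comment> \<open>Chosen so that the summand at y exceeds the bound by at least 1; the cap 1/2
    ensures \<open>t < 1\<close>.\<close>
  define t where "t = min (1 / 2) (exp (- (info P + ent u + 1) / W u y) / W u y)"
  have t: "0 < t" "t < 1" using \<open>W u y > 0\<close> by (auto simp: t_def)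
  have "t * W u y \<le> exp (- (info P + ent u + 1) / W u y)"
    unfolding pos_le_divide_eq[OF \<open>W u y > 0\<close>, symmetric] t_def by (rule min.cobounded2)
  then have "ln (t * W u y) \<le> - (info P + ent u + 1) / W u y"
    using t \<open>W u y > 0\<close> ln_le_cancel_iff[of "t * W u y" "exp (- (info P + ent u + 1) / W u y)"] by simp
  then have "W u y * ln (t * W u y) \<le> - (info P + ent u + 1)"
    using \<open>W u y > 0\<close> by (simp add: pos_le_divide_eq mult.commute)
  then show False using le[OF t] by simp
qed

text \<open>That is, D(W u || out P) <= info P. The limit is legitimate because
  \<open>out P y > 0\<close> wherever \<open>W u y > 0\<close>.\<close>

lemma max_info_kuhn_tucker:
  assumes P: "optimal P"
  shows "(\<Sum>y\<in>UNIV. - W u y * ln (out P y)) \<le> info P + ent u"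
proof (rule tendsto_upperbound)
  show "((\<lambda>t. \<Sum>y\<in>UNIV. - W u y * ln ((1 - t) * out P y + t * W u y))
      \<longlongrightarrow> (\<Sum>y\<in>UNIV. - W u y * ln (out P y))) (at_right 0)"
  proof (rule tendsto_sum)
    fix y
    show "((\<lambda>t. - W u y * ln ((1 - t) * out P y + t * W u y)) \<longlongrightarrow> - W u y * ln (out P y)) (at_right 0)"
    proof (cases "W u y = 0")
      case False
      then have "out P y > 0" using max_info_out_pos[OF P, of u y] W_nonneg[of u y] by simp
      then show ?thesis by (auto intro!: tendsto_eq_intros)
    qed auto
  qed
  have "\<forall>\<^sub>F t in at_right 0. 0 < t \<and> t < (1::real)" by (auto intro: eventually_at_rightI[of 0 1])
  then show "\<forall>\<^sub>F t in at_right 0. (\<Sum>y\<in>UNIV. - W u y * ln ((1 - t) * out P y + t * W u y)) \<le> info P + ent u"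
    by eventually_elim (use sum_ln_out_mix_le[OF P] in blast)
qed auto

text \<open>
  The Donsker-Varadhan form of \<open>D(W u || out P) \<le> info P\<close>. It is linear in \<open>W u\<close>, which allows
  the induction over the blocks in the converse to go through without conditional laws.
\<close>

lemma max_info_ln_le:
  assumes P: "optimal P"
    and v: "\<And>y. v y > 0"
  shows "(\<Sum>y\<in>UNIV. W u y * ln (v y)) \<le> info P + ln (\<Sum>y\<in>UNIV. out P y * v y)"
proof -
  define Z where "Z = (\<Sum>y\<in>UNIV. out P y * v y)"
  have o: "0 \<le> out P y" "(\<Sum>y\<in>UNIV. out P y) = 1" for y
    using is_dist_out P by (auto simp: is_dist_def optimal_def)
  then obtain y0 where "out P y0 \<noteq> 0" by (metis sum.neutral zero_neq_one)
  then have Z: "Z > 0" unfolding Z_def using o v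
    by (intro sum_pos2[of _ y0]) (auto simp: less_le)
  \<comment> \<open>Gibbs' inequality per cell, comparing \<open>W u\<close> with the tilted law
    \<open>out P y * v y / Z\<close>.\<close>
  have *: "W u y * ln (v y) + W u y * ln (out P y) + eta (W u y) - W u y * ln Z \<le> out P y * v y / Z - W u y" for y
  proof (cases "W u y = 0")
    case True
    then show ?thesis using o v[of y] Z by (simp add: eta_def)
  next
    case False
    then have w: "W u y > 0" using W_nonneg[of u y] by simp
    then have oy: "out P y > 0" by (rule max_info_out_pos[OF P])
    have "W u y * ln (v y) + W u y * ln (out P y) + eta (W u y) - W u y * ln Z
        = W u y * ln (out P y * v y / (Z * W u y))"
      using w oy v[of y] Z by (simp add: eta_def ln_div ln_mult algebra_simps)
    also have "\<dots> \<le> W u y * (out P y * v y / (Z * W u y) - 1)"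
      using w oy v[of y] Z by (intro mult_left_mono ln_le_minus_one) auto
    finally show ?thesis using w by (simp add: algebra_simps)
  qed
  have "(\<Sum>y\<in>UNIV. W u y * ln (v y) + W u y * ln (out P y) + eta (W u y) - W u y * ln Z)
      \<le> (\<Sum>y\<in>UNIV. out P y * v y / Z - W u y)"
    by (intro sum_mono *)
  also have "\<dots> = 0"
    using Z by (simp add: sum_subtractf W_sum sum_divide_distrib[symmetric] Z_def[symmetric])
  finally have "(\<Sum>y\<in>UNIV. W u y * ln (v y)) + (\<Sum>y\<in>UNIV. W u y * ln (out P y)) + ent u - ln Z \<le> 0"
    by (simp add: sum.distrib sum_subtractf ent_def sum_distrib_right[symmetric] W_sum)
  then show ?thesis using max_info_kuhn_tucker[OF P, of u] by (simp add: Z_def sum_negf)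
qed

end

subsection \<open>Coding for a memoryless channel\<close>

text \<open>Each decoding region has \<open>Q\<close>-mass at most \<open>1 / a\<close>, as
  \<open>a * Q y\<close> is at most the codeword's likelihood there. If no codeword could be added,
  averaging over \<open>P\<close> would bound 1 by \<open>1 - \<epsilon>\<close> plus the decided
  and the atypical mass, which is less than 1.\<close>

lemma feinstein:
  fixes P :: "'a \<Rightarrow> real" and V :: "'a \<Rightarrow> 'c \<Rightarrow> real"
  assumes fin: "finite X" "finite Y"
    and P: "\<And>x. x \<in> X \<Longrightarrow> 0 \<le> P x" "sum P X = 1"
    and V: "\<And>x y. x \<in> X \<Longrightarrow> y \<in> Y \<Longrightarrow> 0 \<le> V x y" "\<And>x. x \<in> X \<Longrightarrow> (\<Sum>y\<in>Y. V x y) = 1"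
    and Q: "\<And>y. y \<in> Y \<Longrightarrow> Q y = (\<Sum>x\<in>X. P x * V x y)"
    and a: "a > 0"
    and M: "real M / a + (\<Sum>x\<in>X. P x * (\<Sum>y | y \<in> Y \<and> V x y < a * Q y. V x y)) < \<epsilon>"
  shows "\<exists>c dec. \<forall>w<M. c w \<in> X \<and> (\<Sum>y | y \<in> Y \<and> dec y = w. V (c w) y) \<ge> 1 - \<epsilon>"
proof -
  \<comment> \<open>\<open>dec y \<ge> k\<close> means that \<open>y\<close> is not yet assigned to any of the first \<open>k\<close> codewords.\<close>
  have *: "\<exists>c dec. (\<forall>w<k. c w \<in> X \<and> (\<Sum>y | y \<in> Y \<and> dec y = w. V (c w) y) \<ge> 1 - \<epsilon>)
        \<and> (\<forall>y\<in>Y. dec y < k \<longrightarrow> a * Q y \<le> V (c (dec y)) y)" if "k \<le> M" for k :: nat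
    using that
  proof (induction k)
    case (Suc k)
    then obtain c dec where c: "\<And>w. w < k \<Longrightarrow> c w \<in> X"
      "\<And>w. w < k \<Longrightarrow> (\<Sum>y | y \<in> Y \<and> dec y = w. V (c w) y) \<ge> 1 - \<epsilon>"
      and dec: "\<And>y. y \<in> Y \<Longrightarrow> dec y < k \<Longrightarrow> a * Q y \<le> V (c (dec y)) y"
      by auto
    have "\<exists>x\<in>X. (\<Sum>y | y \<in> Y \<and> \<not> dec y < k \<and> a * Q y \<le> V x y. V x y) \<ge> 1 - \<epsilon>"
    proof (rule ccontr)
      assume "\<not> ?thesis"
      then have small: "(\<Sum>y | y \<in> Y \<and> \<not> dec y < k \<and> a * Q y \<le> V x y. V x y) \<le> 1 - \<epsilon>" if "x \<in> X" for x
        using that by force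
      \<comment> \<open>Every output is free and typical for x, already decided, or atypical for
        x.\<close>
      have split: "1 \<le> (\<Sum>y | y \<in> Y \<and> \<not> dec y < k \<and> a * Q y \<le> V x y. V x y)
          + (\<Sum>y | y \<in> Y \<and> dec y < k. V x y) + (\<Sum>y | y \<in> Y \<and> V x y < a * Q y. V x y)" if "x \<in> X" for x
      proof -
        have "(\<Sum>y\<in>Y. V x y) \<le> (\<Sum>y\<in>Y. (if \<not> dec y < k \<and> a * Q y \<le> V x y then V x y else 0)
            + (if dec y < k then V x y else 0) + (if V x y < a * Q y then V x y else 0))"
          using V(1)[OF that] by (intro sum_mono) auto
        then show ?thesis using fin V(2)[OF that]
          by (simp add: sum.distrib sum.inter_filter[symmetric])
      qed
      have decided: "(\<Sum>x\<in>X. P x * (\<Sum>y | y \<in> Y \<and> dec y < k. V x y)) \<le> real k / a"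
      proof -
        have "(\<Sum>x\<in>X. P x * (\<Sum>y | y \<in> Y \<and> dec y < k. V x y)) = (\<Sum>y | y \<in> Y \<and> dec y < k. Q y)"
          unfolding sum_distrib_left by (subst sum.swap) (simp add: Q)
        also have "\<dots> = (\<Sum>w<k. \<Sum>y | y \<in> {y \<in> Y. dec y < k} \<and> dec y = w. Q y)"
          using fin by (intro sum.group[symmetric]) auto
        also have "\<dots> \<le> (\<Sum>w<k. 1 / a)"
        proof (rule sum_mono)
          fix w assume "w \<in> {..<k}"
          then have w: "w < k" by simp
          have "(\<Sum>y | y \<in> {y \<in> Y. dec y < k} \<and> dec y = w. Q y)
              \<le> (\<Sum>y | y \<in> {y \<in> Y. dec y < k} \<and> dec y = w. V (c w) y / a)"
            using dec w a by (intro sum_mono) (auto simp: field_simps)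
          also have "\<dots> \<le> (\<Sum>y\<in>Y. V (c w) y / a)"
            using fin V(1)[OF c(1)[OF w]] a by (intro sum_mono2) auto
          also have "\<dots> = 1 / a" using V(2)[OF c(1)[OF w]] by (simp add: sum_divide_distrib[symmetric])
          finally show "(\<Sum>y | y \<in> {y \<in> Y. dec y < k} \<and> dec y = w. Q y) \<le> 1 / a" .
        qed
        finally show ?thesis by simp
      qed
      have "1 = (\<Sum>x\<in>X. P x * 1)" using P by simp
      also have "\<dots> \<le> (\<Sum>x\<in>X. P x * ((1 - \<epsilon>)
          + (\<Sum>y | y \<in> Y \<and> dec y < k. V x y) + (\<Sum>y | y \<in> Y \<and> V x y < a * Q y. V x y)))"
        using split small P by (intro sum_mono mult_left_mono) (smt (verit))+
      also have "\<dots> = (1 - \<epsilon>) + (\<Sum>x\<in>X. P x * (\<Sum>y | y \<in> Y \<and> dec y < k. V x y))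
          + (\<Sum>x\<in>X. P x * (\<Sum>y | y \<in> Y \<and> V x y < a * Q y. V x y))"
        using P(2) by (simp add: distrib_left sum.distrib sum_distrib_right[symmetric])
      also have "\<dots> \<le> (1 - \<epsilon>) + real M / a + (\<Sum>x\<in>X. P x * (\<Sum>y | y \<in> Y \<and> V x y < a * Q y. V x y))"
        using decided Suc.prems a by (smt (verit) divide_right_mono of_nat_mono Suc_leD)
      also have "\<dots> < 1" using M by simp
      finally show False by simp
    qed
    then obtain x where x: "x \<in> X" "(\<Sum>y | y \<in> Y \<and> \<not> dec y < k \<and> a * Q y \<le> V x y. V x y) \<ge> 1 - \<epsilon>"
      by blast
    define c' where "c' = c(k := x)"
    \<comment> \<open>The value \<open>Suc k\<close> keeps y unassigned among the first
      \<open>Suc k\<close> codewords.\<close>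
    define dec' where "dec' y = (if dec y < k then dec y else if a * Q y \<le> V x y then k else Suc k)" for y
    have "{y \<in> Y. dec' y = w} = {y \<in> Y. dec y = w}" if "w < k" for w
      using that by (auto simp: dec'_def)
    moreover have "{y \<in> Y. dec' y = k} = {y \<in> Y. \<not> dec y < k \<and> a * Q y \<le> V x y}"
      by (auto simp: dec'_def)
    ultimately have "\<forall>w<Suc k. c' w \<in> X \<and> (\<Sum>y | y \<in> Y \<and> dec' y = w. V (c' w) y) \<ge> 1 - \<epsilon>"
      using x c by (auto simp: less_Suc_eq c'_def)
    moreover have "\<forall>y\<in>Y. dec' y < Suc k \<longrightarrow> a * Q y \<le> V (c' (dec' y)) y"
      using dec by (auto simp: dec'_def c'_def)
    ultimately show ?case by blast
  qed simp
  show ?thesis using *[of M] by blast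
qed

section \<open>Chernoff bound and block codes\<close>

context finite_channel begin

definition word_dist :: "('u \<Rightarrow> real) \<Rightarrow> nat \<Rightarrow> 'u list \<Rightarrow> real" where
  "word_dist P n us = (\<Prod>i<n. P (us ! i))"

definition word_channel :: "nat \<Rightarrow> 'u list \<Rightarrow> 'y list \<Rightarrow> real" where
  "word_channel n us ys = (\<Prod>i<n. W (us ! i) (ys ! i))"

text \<open>As a function of s the expression extends to the value 1 at 0 with derivative
  \<open>R - info P < 0\<close>.\<close>

lemma chernoff_rate:
  assumes P: "is_dist P" and R: "R < info P"
  obtains s where "s > 0"
    "exp (s * R) * (\<Sum>u\<in>UNIV. \<Sum>y\<in>UNIV. P u * W u y * (out P y / W u y) powr s) < 1"
proof -
  \<comment> \<open>With \<open>exp\<close> in place of \<open>powr\<close> every term is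
    differentiable at 0; cells where the two differ have weight 0.\<close>
  define \<theta> where "\<theta> s = exp (s * R) * (\<Sum>u\<in>UNIV. \<Sum>y\<in>UNIV. P u * W u y * exp (- s * ln (W u y / out P y)))" for s
  have "\<theta> 0 = 1"
    using P by (simp add: \<theta>_def sum_distrib_left[symmetric] W_sum is_dist_def)
  have "(\<theta> has_real_derivative R * (\<Sum>u\<in>UNIV. \<Sum>y\<in>UNIV. P u * W u y) - info P) (at 0)"
    unfolding \<theta>_def[abs_def] info_eq_sum_ln[OF P]
    by (auto intro!: derivative_eq_intros simp: sum_negf algebra_simps)
  moreover have "(\<Sum>u\<in>UNIV. \<Sum>y\<in>UNIV. P u * W u y) = 1"
    using P by (simp add: sum_distrib_left[symmetric] W_sum is_dist_def)
  ultimately obtain d where d: "d > 0" "\<And>h. 0 < h \<Longrightarrow> h < d \<Longrightarrow> \<theta> (0 + h) < \<theta> 0"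
    using DERIV_neg_dec_right[of \<theta> "R - info P" 0] R by auto
  have "P u * W u y * (out P y / W u y) powr s = P u * W u y * exp (- s * ln (W u y / out P y))" for u y s
  proof (cases "P u = 0 \<or> W u y = 0")
    case False
    then have "P u > 0" "W u y > 0" using P W_nonneg by (auto simp: is_dist_def less_le)
    then show ?thesis using out_pos[OF P, of u y] by (simp add: powr_def ln_div algebra_simps)
  qed auto
  then have eq: "exp (s * R) * (\<Sum>u\<in>UNIV. \<Sum>y\<in>UNIV. P u * W u y * (out P y / W u y) powr s) = \<theta> s" for s
    by (simp only: \<theta>_def)
  have "d / 2 > 0" "\<theta> (d / 2) < 1" using d(1) d(2)[of "d / 2"] \<open>\<theta> 0 = 1\<close> by simp_all
  then show ?thesis by (intro that[of "d / 2"]) (simp_all only: eq)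
qed

text \<open>On atypical pairs the s-th power of threshold over likelihood is at least 1. Inserting
  it and then summing over all pairs gives a product over the positions.\<close>

lemma word_channel_atypical_le:
  assumes P: "is_dist P" and s: "s > 0"
  shows "(\<Sum>us\<in>words n. word_dist P n us *
        (\<Sum>ys | ys \<in> words n \<and> word_channel n us ys < exp (n * R) * (\<Prod>i<n. out P (ys ! i)). word_channel n us ys))
      \<le> (exp (s * R) * (\<Sum>u\<in>UNIV. \<Sum>y\<in>UNIV. P u * W u y * (out P y / W u y) powr s)) ^ n"
proof -
  let ?A = "\<lambda>us ys. word_channel n us ys < exp (n * R) * (\<Prod>i<n. out P (ys ! i))"
  let ?t = "\<lambda>u y. exp (s * R) * (P u * W u y * (out P y / W u y) powr s)"
  have P_nonneg: "0 \<le> P u" for u using P by (simp add: is_dist_def)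
  have o: "0 \<le> out P y" for y using is_dist_out[OF P] by (simp add: is_dist_def)
  have *: "word_dist P n us * (if ?A us ys then word_channel n us ys else 0) \<le> (\<Prod>i<n. ?t (us ! i) (ys ! i))" for us ys
  proof (cases "?A us ys \<and> word_channel n us ys \<noteq> 0")
    case True
    have w: "word_channel n us ys > 0"
      using True W_nonneg by (auto simp: word_channel_def less_le prod_nonneg)
    let ?x = "exp (n * R) * (\<Prod>i<n. out P (ys ! i)) / word_channel n us ys"
    have "1 \<le> ?x" using True w by (simp add: field_simps)
    then have "1 \<le> ?x powr s" using s by (simp add: ge_one_powr_ge_zero)
    moreover have "0 \<le> word_dist P n us * word_channel n us ys"
      using w P_nonneg by (simp add: word_dist_def prod_nonneg)
    ultimately have "word_dist P n us * word_channel n us ys \<le> word_dist P n us * word_channel n us ys * ?x powr s"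
      using mult_left_mono by fastforce
    also have "?x powr s = exp (s * R) ^ n * (\<Prod>i<n. (out P (ys ! i) / W (us ! i) (ys ! i)) powr s)"
    proof -
      have "?x = exp (n * R) * (\<Prod>i<n. out P (ys ! i) / W (us ! i) (ys ! i))"
        by (simp add: word_channel_def prod_dividef)
      also have "\<dots> powr s = exp (n * R) powr s * (\<Prod>i<n. (out P (ys ! i) / W (us ! i) (ys ! i)) powr s)"
        using o W_nonneg by (simp add: powr_mult prod_nonneg prod_powr_distrib)
      also have "exp (n * R) powr s = exp (s * R) ^ n"
        by (simp add: powr_def exp_of_nat_mult[symmetric] mult_ac)
      finally show ?thesis .
    qed
    also have "word_dist P n us * word_channel n us ys * (exp (s * R) ^ n * (\<Prod>i<n. (out P (ys ! i) / W (us ! i) (ys ! i)) powr s))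
        = (\<Prod>i<n. ?t (us ! i) (ys ! i))"
      by (simp add: word_dist_def word_channel_def prod.distrib)
    finally show ?thesis using True by simp
  next
    case False
    have "0 \<le> (\<Prod>i<n. ?t (us ! i) (ys ! i))" using P_nonneg W_nonneg by (intro prod_nonneg) auto
    then show ?thesis using False by auto
  qed
  have "(\<Sum>us\<in>words n. word_dist P n us * (\<Sum>ys | ys \<in> words n \<and> ?A us ys. word_channel n us ys))
      = (\<Sum>us\<in>words n. \<Sum>ys\<in>words n. word_dist P n us * (if ?A us ys then word_channel n us ys else 0))"
    unfolding sum_distrib_left[symmetric]
    by (intro sum.cong refl arg_cong2[of _ _ _ _ "(*)"] sum.inter_filter) simp
  also have "\<dots> \<le> (\<Sum>us\<in>words n. \<Sum>ys\<in>words n. \<Prod>i<n. ?t (us ! i) (ys ! i))"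
    by (intro sum_mono *)
  also have "\<dots> = (\<Sum>u\<in>UNIV. \<Sum>y\<in>UNIV. ?t u y) ^ n"
  proof -
    have "(\<Sum>ys\<in>words n. \<Prod>i<n. ?t (us ! i) (ys ! i)) = (\<Prod>i<n. \<Sum>y\<in>UNIV. ?t (us ! i) y)" for us
      by (rule sum_words_prod)
    then show ?thesis by (simp add: sum_words_prod[of "\<lambda>_ u. \<Sum>y\<in>UNIV. ?t u y" n])
  qed
  finally show ?thesis by (simp add: sum_distrib_left)
qed


lemma ex_code:
  assumes P: "is_dist P" and R: "0 \<le> R" "R < info P" and \<epsilon>: "\<epsilon> > 0"
  shows "\<exists>n>0. \<exists>M>0. real n * R \<le> ln (real M) \<and> (\<exists>c dec. \<forall>w<M. length (c w) = n \<and>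
    (\<Sum>ys | ys \<in> words n \<and> dec ys = w. word_channel n (c w) ys) \<ge> 1 - \<epsilon>)"
proof -
  obtain R' where R': "R < R'" "R' < info P" using R(2) dense by blast
  obtain s where s: "s > 0"
    "exp (s * R') * (\<Sum>u\<in>UNIV. \<Sum>y\<in>UNIV. P u * W u y * (out P y / W u y) powr s) < 1" (is "?r < 1")
    using chernoff_rate[OF P R'(2)] .
  have P_nonneg: "0 \<le> P u" for u using P by (simp add: is_dist_def)
  have "0 \<le> ?r" using P_nonneg W_nonneg by (intro mult_nonneg_nonneg sum_nonneg) auto
  \<comment> \<open>With \<open>M\<close> the ceiling of \<open>exp (n * R)\<close> and threshold
    \<open>exp (n * R')\<close>, the first two terms bound \<open>M\<close> over the threshold, the
    second paying for rounding; the third bounds the atypical mass.\<close>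
  then have "(\<lambda>n. exp (R - R') ^ n + exp (- R') ^ n + ?r ^ n) \<longlonglongrightarrow> 0 + 0 + 0"
    using s(2) R R'(1) by (intro tendsto_add LIMSEQ_realpow_zero) auto
  then have "\<forall>\<^sub>F n in sequentially. exp (R - R') ^ n + exp (- R') ^ n + ?r ^ n < \<epsilon>"
    using order_tendstoD(2)[OF _ \<epsilon>] by simp
  with eventually_gt_at_top[of "0::nat"] have "\<forall>\<^sub>F n in sequentially. n > 0 \<and> exp (R - R') ^ n + exp (- R') ^ n + ?r ^ n < \<epsilon>"
    by (rule eventually_conj)
  then obtain n where n: "n > 0" "exp (R - R') ^ n + exp (- R') ^ n + ?r ^ n < \<epsilon>"
    using eventually_happens' by (metis (no_types, lifting) sequentially_bot)
  define M where "M = nat \<lceil>exp (real n * R)\<rceil>"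
  define Q where "Q ys = (\<Prod>i<n. out P (ys ! i))" for ys
  have M: "exp (real n * R) \<le> real M" "real M \<le> exp (real n * R) + 1"
    unfolding M_def using exp_gt_zero[of "real n * R"] ceiling_correct[of "exp (real n * R)"]
    by (auto simp del: exp_gt_zero)
  then have M_pos: "M > 0" by (metis exp_gt_zero gr0I leD of_nat_0)
  have rate: "real n * R \<le> ln (real M)" using M(1) M_pos by (simp add: ln_ge_iff)
  have "\<exists>c dec. \<forall>w<M. c w \<in> words n \<and> (\<Sum>ys | ys \<in> words n \<and> dec ys = w. word_channel n (c w) ys) \<ge> 1 - \<epsilon>"
  proof (rule feinstein)
    show "finite (words n :: 'u list set)" "finite (words n :: 'y list set)" by auto
    show "0 \<le> word_dist P n us" for us using P_nonneg by (simp add: word_dist_def prod_nonneg)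
    show "sum (word_dist P n) (words n) = 1"
      using P by (simp add: word_dist_def sum_words_prod[of "\<lambda>_. P" n] is_dist_def)
    show "0 \<le> word_channel n us ys" for us ys using W_nonneg by (simp add: word_channel_def prod_nonneg)
    show "sum (word_channel n us) (words n) = 1" for us
      by (simp add: word_channel_def sum_words_prod[of "\<lambda>i. W (us ! i)" n] W_sum)
    show "Q ys = (\<Sum>us\<in>words n. word_dist P n us * word_channel n us ys)" for ys
      unfolding word_dist_def word_channel_def prod.distrib[symmetric] Q_def
      by (simp add: sum_words_prod[of "\<lambda>i u. P u * W u (ys ! i)" n] out_def)
    show "exp (real n * R') > 0" by simp
    have "real M / exp (real n * R') \<le> (exp (real n * R) + 1) / exp (real n * R')"
      using M(2) by (intro divide_right_mono) auto
    also have "\<dots> = exp (R - R') ^ n + exp (- R') ^ n"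
    proof -
      have "exp (R - R') ^ n = exp (real n * R) / exp (real n * R')"
        by (subst exp_of_nat_mult[symmetric]) (simp add: exp_diff right_diff_distrib)
      moreover have "exp (- R') ^ n = 1 / exp (real n * R')"
        by (subst exp_of_nat_mult[symmetric]) (simp add: exp_minus inverse_eq_divide)
      ultimately show ?thesis by (simp add: add_divide_distrib)
    qed
    finally show "real M / exp (real n * R') + (\<Sum>us\<in>words n. word_dist P n us *
        (\<Sum>ys | ys \<in> words n \<and> word_channel n us ys < exp (real n * R') * Q ys. word_channel n us ys)) < \<epsilon>"
      using word_channel_atypical_le[OF P s(1), of n R'] n(2) by (simp add: Q_def)
  qed
  then show ?thesis using n(1) M_pos rate by auto
qed
end

subsection \<open>Probabilities of states and outputs\<close>

lemma (in prob_space) prob_sum_eq_partition: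
  fixes X :: "'a \<Rightarrow> 'c::finite"
  assumes "\<And>x. {z \<in> space M. Q z \<and> X z = x} \<in> events"
  shows "prob {z \<in> space M. Q z} = (\<Sum>x\<in>UNIV. prob {z \<in> space M. Q z \<and> X z = x})"
proof -
  have "prob (\<Union>x. {z \<in> space M. Q z \<and> X z = x}) = (\<Sum>x\<in>UNIV. prob {z \<in> space M. Q z \<and> X z = x})"
    using assms by (intro finite_measure_finite_Union) (auto simp: disjoint_family_on_def)
  moreover have "(\<Union>x. {z \<in> space M. Q z \<and> X z = x}) = {z \<in> space M. Q z}" by auto
  ultimately show ?thesis by simp
qed

lemma (in prob_space) distributed_count_space_finite:
  fixes X :: "'a \<Rightarrow> 'c::finite"
  assumes "X \<in> measurable M (count_space UNIV)"
  shows "distributed M (count_space UNIV) X (\<lambda>x. prob {z \<in> space M. X z = x})"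
proof -
  have "simple_function M X"
    using assms by (auto simp: simple_function_def intro!: measurable_sets)
  moreover have "X -` {x} \<inter> space M = {z \<in> space M. X z = x}" for x by auto
  ultimately have "distributed M (count_space UNIV) X
      (\<lambda>x. if x \<in> X ` space M then prob {z \<in> space M. X z = x} else 0)"
    using distributed_simple_function_superset[of X "\<lambda>x. prob {z \<in> space M. X z = x}" UNIV] by simp
  moreover have "(if x \<in> X ` space M then prob {z \<in> space M. X z = x} else 0)
      = prob {z \<in> space M. X z = x}" for x
  proof (cases "x \<in> X ` space M")
    case False
    then have "{z \<in> space M. X z = x} = {}" by auto
    then show ?thesis using False by (simp only: measure_empty if_False)
  qed simp
  ultimately show ?thesis by simp
qed

lemma (in information_space) mutual_information_finite:
  fixes X :: "'a \<Rightarrow> 'c::finite" and Y :: "'a \<Rightarrow> 'd::finite"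
  assumes [measurable]: "X \<in> measurable M (count_space UNIV)" "Y \<in> measurable M (count_space UNIV)"
  shows "mutual_information b (count_space UNIV) (count_space UNIV) X Y =
    (\<Sum>x\<in>UNIV. \<Sum>y\<in>UNIV. prob {z \<in> space M. X z = x \<and> Y z = y} *
      log b (prob {z \<in> space M. X z = x \<and> Y z = y} / (prob {z \<in> space M. X z = x} * prob {z \<in> space M. Y z = y})))"
proof -
  have pair: "count_space UNIV \<Otimes>\<^sub>M count_space UNIV = count_space (UNIV :: ('c \<times> 'd) set)"
    by (simp add: pair_measure_count_space)
  have XY: "distributed M (count_space UNIV \<Otimes>\<^sub>M count_space UNIV) (\<lambda>z. (X z, Y z))
      (\<lambda>p. prob {z \<in> space M. (X z, Y z) = p})"
    unfolding pair by (rule distributed_count_space_finite) measurable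
  show ?thesis
    by (subst mutual_information_distr[OF _ _ distributed_count_space_finite[OF assms(1)] _
          distributed_count_space_finite[OF assms(2)] _ XY])
       (auto simp: sigma_finite_measure_count_space_finite pair lebesgue_integral_count_space_finite
          sum.cartesian_product case_prod_beta prod_eq_iff)
qed

section \<open>The single-block channel with strategies as inputs\<close>

locale action_state_channel = prob_space N for N :: "'z measure" +
  fixes f :: "'x::finite \<Rightarrow> 's::finite \<Rightarrow> 'z \<Rightarrow> 'y::finite" and g :: "'b::finite \<Rightarrow> 'z \<Rightarrow> 's"
  assumes g_measurable [measurable]: "\<And>b. g b \<in> measurable N (count_space UNIV)"
    and f_measurable [measurable]: "\<And>x s. f x s \<in> measurable N (count_space UNIV)"
begin

text \<open>A joint probability, since the same noise may drive both the state and the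
  output.\<close>

definition slot_prob :: "'b \<Rightarrow> 's \<Rightarrow> 'x \<Rightarrow> 'y \<Rightarrow> real" where
  "slot_prob b s x y = prob {z \<in> space N. g b z = s \<and> f x s z = y}"

definition strategy_channel :: "'b \<times> ('s \<Rightarrow> 'x) \<Rightarrow> 'y \<Rightarrow> real" where
  "strategy_channel u y = prob {z \<in> space N. single_block_output f g (u, z) = y}"

lemma single_block_output_measurable [measurable]:
  "(\<lambda>z. single_block_output f g (u, z)) \<in> measurable N (count_space UNIV)"
  unfolding single_block_output_def Let_def case_prod_beta fst_conv snd_conv
  by (rule measurable_compose_countable[where f = "\<lambda>s z. f (snd u s) s z"]) simp_all

text \<open>The strategy enters the summand of s only through \<open>a s\<close>; this makes the
  support bound in terms of states possible.\<close>

lemma strategy_channel_eq_sum: "strategy_channel (b, a) y = (\<Sum>s\<in>UNIV. slot_prob b s (a s) y)"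
proof -
  have "strategy_channel (b, a) y
      = (\<Sum>s\<in>UNIV. prob {z \<in> space N. single_block_output f g ((b, a), z) = y \<and> g b z = s})"
    unfolding strategy_channel_def by (rule prob_sum_eq_partition) measurable
  also have "\<dots> = (\<Sum>s\<in>UNIV. slot_prob b s (a s) y)"
    unfolding slot_prob_def
    by (intro sum.cong refl arg_cong[of _ _ prob]) (auto simp: single_block_output_def Let_def)
  finally show ?thesis .
qed

sublocale finite_channel strategy_channel
proof
  show "0 \<le> strategy_channel u y" for u y by (simp add: strategy_channel_def)
  show "(\<Sum>y\<in>UNIV. strategy_channel u y) = 1" for u
    using prob_sum_eq_partition[of "\<lambda>_. True" "\<lambda>z. single_block_output f g (u, z)"]
    by (simp add: strategy_channel_def prob_space)
qed

lemma block_information_eq: "block_information N f g P = info (pmf P) / ln 2"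
proof -
  let ?M = "measure_pmf P \<Otimes>\<^sub>M N"
  let ?Y = "single_block_output f g"
  interpret pair: pair_prob_space "measure_pmf P" N ..
  interpret pair: information_space ?M 2 by standard simp
  \<comment> \<open>With a discrete first factor, measurability on the product reduces to
    measurability of the sections in z.\<close>
  have sets: "sets ?M = sets (count_space UNIV \<Otimes>\<^sub>M N)"
    by (intro sets_pair_measure_cong) auto
  have [measurable]: "fst \<in> measurable ?M (count_space UNIV)"
    by (simp add: measurable_cong_sets[OF sets refl])
  have [measurable]: "?Y \<in> measurable ?M (count_space UNIV)"
    unfolding measurable_cong_sets[OF sets refl]
    by (rule measurable_pair_measure_countable1) (auto simp: countable_finite)
  have joint: "pair.prob {z \<in> space ?M. fst z = u \<and> ?Y z = y} = pmf P u * strategy_channel u y" for u y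
  proof -
    have "{z \<in> space ?M. fst z = u \<and> ?Y z = y} = {u} \<times> {z \<in> space N. ?Y (u, z) = y}"
      by (auto simp: space_pair_measure)
    moreover have "{z \<in> space N. ?Y (u, z) = y} \<in> events" by measurable
    ultimately show ?thesis
      by (simp add: measure_def emeasure_pair_measure_Times enn2real_mult strategy_channel_def pmf.rep_eq)
  qed
  have X: "pair.prob {z \<in> space ?M. fst z = u} = pmf P u" for u
    using pair.prob_sum_eq_partition[of "\<lambda>z. fst z = u" ?Y]
    by (simp add: joint sum_distrib_left[symmetric] W_sum)
  have Y: "pair.prob {z \<in> space ?M. ?Y z = y} = out (pmf P) y" for y
    using pair.prob_sum_eq_partition[of "\<lambda>z. ?Y z = y" fst]
    by (simp add: joint conj_commute out_def)
  have P: "is_dist (pmf P)" by (simp add: is_dist_def sum_pmf_eq_1)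
  show ?thesis
    unfolding block_information_def info_eq_sum_ln[OF P]
    by (subst pair.mutual_information_finite)
       (auto simp: joint X Y log_def sum_divide_distrib intro!: sum.cong)
qed

section \<open>Joint law of states and outputs under a code\<close>

lemma state_seq_eq_iff:
  "state_seq g act w z n = ss \<longleftrightarrow>
    length ss = n \<and> (\<forall>i<n. g (act w (take i ss)) (z i) = ss ! i)"
proof (induction n arbitrary: ss)
  case (Suc n)
  show ?case
  proof (cases ss rule: rev_cases)
    case (snoc ss' s)
    then show ?thesis
      using Suc[of ss'] by (auto simp: Let_def nth_append less_Suc_eq all_conj_distrib)
  qed (auto simp: Let_def)
qed auto

lemma length_state_seq [simp]: "length (state_seq g act w z n) = n"
  using state_seq_eq_iff by blast

lemma take_state_seq: "i \<le> n \<Longrightarrow> take i (state_seq g act w z n) = state_seq g act w z i"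
proof (induction n)
  case (Suc n)
  then show ?case by (cases "i = Suc n") (auto simp: Let_def)
qed auto

text \<open>
  Once all states are prescribed, every action and input is known, so the event that the states
  and outputs take given values is a product of conditions on the separate noise variables.
\<close>

lemma state_outputs_eq_iff:
  assumes "length ss = n" "length ys = n"
  shows "state_seq g act w z n = ss \<and> map (block_output f g act inp w z) [0..<n] = ys \<longleftrightarrow>
    (\<forall>i<n. g (act w (take i ss)) (z i) = ss ! i \<and> f (inp w (take (Suc i) ss)) (ss ! i) (z i) = ys ! i)"
proof -
  have "block_output f g act inp w z i = f (inp w (take (Suc i) ss)) (ss ! i) (z i)"
    if ss: "state_seq g act w z n = ss" and i: "i < n" for i
  proof -
    have "state_seq g act w z (Suc i) = take (Suc i) ss"
      unfolding ss[symmetric] using i by (intro take_state_seq[symmetric]) simp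
    moreover have "last (take (Suc i) ss) = ss ! i"
      using i assms(1) by (simp add: take_Suc_conv_app_nth)
    ultimately show ?thesis by (simp only: block_output_def Let_def)
  qed
  then show ?thesis
    using assms state_seq_eq_iff[of act w z n ss] by (auto simp: list_eq_iff_nth_eq)
qed

definition joint_prob ::
  "('c \<Rightarrow> 's list \<Rightarrow> 'b) \<Rightarrow> ('c \<Rightarrow> 's list \<Rightarrow> 'x) \<Rightarrow> 'c \<Rightarrow> nat \<Rightarrow> 's list \<Rightarrow> 'y list \<Rightarrow> real" where
  "joint_prob act inp w n ss ys =
    (\<Prod>i<n. slot_prob (act w (take i ss)) (ss ! i) (inp w (take (Suc i) ss)) (ys ! i))"

lemma joint_prob_nonneg: "0 \<le> joint_prob act inp w n ss ys"
  by (simp add: joint_prob_def slot_prob_def prod_nonneg)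

text \<open>Since \<open>F\<close> ignores the states, the last state can be summed out: given the
  past, the last block is one use of \<open>strategy_channel\<close> with a strategy fixed by the
  message and the past states.\<close>

lemma sum_joint_prob_Suc:
  fixes F :: "'y list \<Rightarrow> real"
  shows "(\<Sum>ss\<in>words (Suc n). \<Sum>ys\<in>words (Suc n). joint_prob act inp w (Suc n) ss ys * F ys) =
    (\<Sum>ss\<in>words n. \<Sum>ys\<in>words n. joint_prob act inp w n ss ys *
      (\<Sum>y\<in>UNIV. strategy_channel (act w ss, \<lambda>s. inp w (ss @ [s])) y * F (ys @ [y])))"
proof -
  have *: "joint_prob act inp w (Suc n) (ss @ [s]) (ys @ [y])
      = joint_prob act inp w n ss ys * slot_prob (act w ss) s (inp w (ss @ [s])) y"
    if "length ss = n" "length ys = n" for ss ys s y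
    unfolding joint_prob_def using that by (auto simp: nth_append intro!: prod.cong)
  have "(\<Sum>ss\<in>words (Suc n). \<Sum>ys\<in>words (Suc n). joint_prob act inp w (Suc n) ss ys * F ys)
      = (\<Sum>ss\<in>words n. \<Sum>s\<in>UNIV. \<Sum>ys\<in>words n. \<Sum>y\<in>UNIV.
          joint_prob act inp w n ss ys * (slot_prob (act w ss) s (inp w (ss @ [s])) y * F (ys @ [y])))"
    unfolding sum_words_Suc by (intro sum.cong refl) (simp add: *)
  also have "\<dots> = (\<Sum>ss\<in>words n. \<Sum>ys\<in>words n. \<Sum>y\<in>UNIV. \<Sum>s\<in>UNIV.
          joint_prob act inp w n ss ys * (slot_prob (act w ss) s (inp w (ss @ [s])) y * F (ys @ [y])))"
    by (rule sum.cong[OF refl]) (subst sum.swap, rule sum.cong[OF refl sum.swap])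
  finally show ?thesis
    by (simp add: strategy_channel_eq_sum sum_distrib_left sum_distrib_right)
qed

lemma sum_joint_prob: "(\<Sum>ss\<in>words n. \<Sum>ys\<in>words n. joint_prob act inp w n ss ys) = 1"
proof (induction n)
  case 0
  then show ?case by (simp add: joint_prob_def)
next
  case (Suc n)
  then show ?case using sum_joint_prob_Suc[of act inp w n "\<lambda>_. 1"] by (simp add: W_sum)
qed

text \<open>The bound of \<open>max_info_ln_le\<close> is uniform in the strategy and its reference
  law \<open>out P\<close> does not depend on the past, so the last block can be peeled off for each
  past separately.\<close>

lemma sum_joint_prob_ln_le:
  assumes P: "optimal P" and "\<And>ys. v ys > 0"
  shows "(\<Sum>ss\<in>words n. \<Sum>ys\<in>words n. joint_prob act inp w n ss ys * ln (v ys))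
    \<le> real n * info P + ln (\<Sum>ys\<in>words n. (\<Prod>i<n. out P (ys ! i)) * v ys)"
  using assms(2)
proof (induction n arbitrary: v)
  case 0
  then show ?case by (simp add: joint_prob_def)
next
  case (Suc n)
  \<comment> \<open>The last output is averaged under \<open>out P\<close>, giving a positive
    function of the earlier outputs for the induction hypothesis.\<close>
  define v' where "v' ys = (\<Sum>y\<in>UNIV. out P y * v (ys @ [y]))" for ys
  have o: "0 \<le> out P y" "(\<Sum>y\<in>UNIV. out P y) = 1" for y
    using is_dist_out P by (auto simp: is_dist_def optimal_def)
  then obtain y0 where "out P y0 \<noteq> 0" by (metis sum.neutral zero_neq_one)
  then have v': "v' ys > 0" for ys
    unfolding v'_def using o Suc.prems by (intro sum_pos2[of _ y0]) (auto simp: less_le)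
  have "(\<Sum>ss\<in>words (Suc n). \<Sum>ys\<in>words (Suc n). joint_prob act inp w (Suc n) ss ys * ln (v ys))
      = (\<Sum>ss\<in>words n. \<Sum>ys\<in>words n. joint_prob act inp w n ss ys *
        (\<Sum>y\<in>UNIV. strategy_channel (act w ss, \<lambda>s. inp w (ss @ [s])) y * ln (v (ys @ [y]))))"
    by (rule sum_joint_prob_Suc)
  also have "\<dots> \<le> (\<Sum>ss\<in>words n. \<Sum>ys\<in>words n. joint_prob act inp w n ss ys * (info P + ln (v' ys)))"
    unfolding v'_def using Suc.prems
    by (intro sum_mono mult_left_mono joint_prob_nonneg max_info_ln_le[OF P])
  also have "\<dots> = info P + (\<Sum>ss\<in>words n. \<Sum>ys\<in>words n. joint_prob act inp w n ss ys * ln (v' ys))"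
    by (simp add: distrib_left sum.distrib sum_distrib_right[symmetric] sum_joint_prob)
  also have "\<dots> \<le> info P + (real n * info P + ln (\<Sum>ys\<in>words n. (\<Prod>i<n. out P (ys ! i)) * v' ys))"
    using Suc.IH[of v'] v' by simp
  also have "(\<Sum>ys\<in>words n. (\<Prod>i<n. out P (ys ! i)) * v' ys)
      = (\<Sum>ys\<in>words (Suc n). (\<Prod>i<Suc n. out P (ys ! i)) * v ys)"
    unfolding sum_words_Suc v'_def sum_distrib_left
    by (intro sum.cong refl) (auto simp: nth_append mult_ac)
  finally show ?case by (simp add: algebra_simps)
qed

lemma prob_state_outputs:
  fixes act :: "nat \<Rightarrow> 's list \<Rightarrow> 'b" and inp :: "nat \<Rightarrow> 's list \<Rightarrow> 'x" and w n :: nat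
  assumes "length ss = n" "length ys = n"
  defines "E \<equiv> {z \<in> space (\<Pi>\<^sub>M i\<in>{..<n}. N). state_seq g act w z n = ss \<and>
    map (block_output f g act inp w z) [0..<n] = ys}"
  shows "E \<in> sets (\<Pi>\<^sub>M i\<in>{..<n}. N)" "measure (\<Pi>\<^sub>M i\<in>{..<n}. N) E = joint_prob act inp w n ss ys"
proof -
  interpret prod: finite_product_prob_space "\<lambda>_. N" "{..<n}"
    by unfold_locales simp
  let ?A = "\<lambda>i. {z \<in> space N. g (act w (take i ss)) z = ss ! i \<and> f (inp w (take (Suc i) ss)) (ss ! i) z = ys ! i}"
  have E: "E = (\<Pi>\<^sub>E i\<in>{..<n}. ?A i)"
  proof -
    have "E = {z \<in> space (\<Pi>\<^sub>M i\<in>{..<n}. N). \<forall>i<n. g (act w (take i ss)) (z i) = ss ! i \<and>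
        f (inp w (take (Suc i) ss)) (ss ! i) (z i) = ys ! i}"
      unfolding E_def by (simp only: state_outputs_eq_iff[OF assms(1,2)])
    then show ?thesis by (simp only: space_PiM PiE_iff set_eq_iff mem_Collect_eq) blast
  qed
  have A: "?A i \<in> events" for i by measurable
  show "E \<in> sets (\<Pi>\<^sub>M i\<in>{..<n}. N)" unfolding E using A by (intro sets_PiM_I_finite) auto
  show "measure (\<Pi>\<^sub>M i\<in>{..<n}. N) E = joint_prob act inp w n ss ys"
    unfolding E using A by (subst prod.prob_times) (simp_all add: joint_prob_def slot_prob_def)
qed

text \<open>For each message the error event is a finite disjoint union of events with prescribed
  states and outputs, which also gives its measurability.\<close>

lemma error_prob_eq:
  assumes "M > 0"
  shows "error_prob N f g M n act inp dec =
    (\<Sum>w<M. \<Sum>ss\<in>words n. \<Sum>ys | ys \<in> words n \<and> dec ys \<noteq> w. joint_prob act inp w n ss ys) / real M"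
proof -
  let ?PM = "\<Pi>\<^sub>M i\<in>{..<n}. N"
  let ?U = "measure_pmf (pmf_of_set {..<M})"
  interpret prod: finite_product_prob_space "\<lambda>_. N" "{..<n}"
    by unfold_locales simp
  define T where "T w = {z \<in> space ?PM. dec (map (block_output f g act inp w z) [0..<n]) \<noteq> w}" for w
  define E where "E w p = {z \<in> space ?PM. state_seq g act w z n = fst p \<and>
    map (block_output f g act inp w z) [0..<n] = snd p}" for w p
  define I :: "nat \<Rightarrow> ('s list \<times> 'y list) set" where "I w = words n \<times> {ys \<in> words n. dec ys \<noteq> w}" for w
  have T_eq: "T w = (\<Union>p\<in>I w. E w p)" for w
    by (auto simp: T_def E_def I_def)
  have fin: "finite (I w)" for w by (simp add: I_def)
  have E: "E w p \<in> sets ?PM" "measure ?PM (E w p) = joint_prob act inp w n (fst p) (snd p)"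
    if "p \<in> I w" for w p
    unfolding E_def using that by (auto simp: I_def intro: prob_state_outputs)
  have T_sets: "T w \<in> sets ?PM" for w
    unfolding T_eq using E fin by (intro sets.finite_UN) auto
  have T_prob: "measure ?PM (T w)
      = (\<Sum>ss\<in>words n. \<Sum>ys | ys \<in> words n \<and> dec ys \<noteq> w. joint_prob act inp w n ss ys)" for w
  proof -
    have "measure ?PM (T w) = (\<Sum>p\<in>I w. measure ?PM (E w p))"
      unfolding T_eq using E fin
      by (intro prod.finite_measure_finite_Union) (auto simp: disjoint_family_on_def E_def prod_eq_iff)
    also have "\<dots> = (\<Sum>(ss, ys)\<in>I w. joint_prob act inp w n ss ys)"
      using E(2) by (intro sum.cong) auto
    finally show ?thesis by (simp add: I_def sum.cartesian_product)
  qed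
  define A where "A = {(w, z) \<in> space (?U \<Otimes>\<^sub>M ?PM). dec (map (block_output f g act inp w z) [0..<n]) \<noteq> w}"
  \<comment> \<open>The union runs over all naturals; messages from \<open>M\<close> on have
    probability 0.\<close>
  have A_eq: "A = (\<Union>w. {w} \<times> T w)" by (auto simp: A_def T_def space_pair_measure)
  have "A \<in> sets (?U \<Otimes>\<^sub>M ?PM)"
    unfolding A_eq using T_sets by (intro sets.countable_UN') auto
  then have "emeasure (?U \<Otimes>\<^sub>M ?PM) A = (\<integral>\<^sup>+w. emeasure ?PM (Pair w -` A) \<partial>?U)"
    by (rule prod.emeasure_pair_measure_alt)
  also have "\<dots> = (\<integral>\<^sup>+w. ennreal (measure ?PM (T w)) \<partial>?U)"
  proof (rule nn_integral_cong)
    fix w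
    have "Pair w -` A = T w" by (auto simp: A_eq)
    then show "emeasure ?PM (Pair w -` A) = ennreal (measure ?PM (T w))"
      by (simp add: prod.emeasure_eq_measure)
  qed
  also have "\<dots> = (\<Sum>w<M. ennreal (measure ?PM (T w))) / ennreal (real M)"
    using assms by (subst nn_integral_pmf_of_set) (auto simp: ennreal_of_nat_eq_real_of_nat)
  also have "\<dots> = ennreal ((\<Sum>w<M. measure ?PM (T w)) / real M)"
    using assms by (simp add: divide_ennreal sum_nonneg)
  finally have "measure (?U \<Otimes>\<^sub>M ?PM) A = (\<Sum>w<M. measure ?PM (T w)) / real M"
    by (simp add: measure_def sum_nonneg)
  then show ?thesis by (simp add: error_prob_def A_def[symmetric] T_prob)
qed

subsection \<open>Converse, achievability and the support bound\<close>

text \<open>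
  Fano's inequality in disguise: \<open>sum_joint_prob_ln_le\<close> is applied with \<open>v = M\<close> on the outputs that
  decode correctly and \<open>v = \<kappa>\<close> on the others. Letting the error tend to 0 before \<open>\<kappa>\<close> removes the error
  term, even for a bounded number of blocks.
\<close>

lemma converse_bound:
  fixes M n :: nat and act :: "nat \<Rightarrow> 's list \<Rightarrow> 'b" and inp :: "nat \<Rightarrow> 's list \<Rightarrow> 'x"
    and dec :: "'y list \<Rightarrow> nat"
  assumes P: "optimal P" and M: "M > 0" and \<kappa>: "\<kappa> > 0"
  defines "e \<equiv> error_prob N f g M n act inp dec"
  shows "(1 - e) * ln (real M) + e * ln \<kappa> \<le> real n * info P + \<kappa>"
proof -
  define Q where "Q ys = (\<Prod>i<n. out P (ys ! i))" for ys
  define q where "q w = (\<Sum>ys | ys \<in> words n \<and> dec ys = w. Q ys)" for w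
  define err where "err w = (\<Sum>ss\<in>words n. \<Sum>ys | ys \<in> words n \<and> dec ys \<noteq> w. joint_prob act inp w n ss ys)" for w
  have o: "0 \<le> out P y" "(\<Sum>y\<in>UNIV. out P y) = 1" for y
    using is_dist_out P by (auto simp: is_dist_def optimal_def)
  have Q: "0 \<le> Q ys" "sum Q (words n) = 1" for ys
    unfolding Q_def using o by (simp_all add: prod_nonneg sum_words_prod[of "\<lambda>_. out P" n])
  have split: "(\<Sum>ys\<in>words n. h ys) = (\<Sum>ys | ys \<in> words n \<and> dec ys = w. h ys) + (\<Sum>ys | ys \<in> words n \<and> dec ys \<noteq> w. h ys)"
    for h :: "'y list \<Rightarrow> real" and w
    by (subst sum.union_disjoint[symmetric]) (auto intro!: sum.cong)
  have w: "(1 - err w) * ln (real M) + err w * ln \<kappa> \<le> real n * info P + (real M * q w + \<kappa> - 1)" for w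
  proof -
    define v where "v ys = (if dec ys = w then real M else \<kappa>)" for ys
    have v: "v ys > 0" for ys using M \<kappa> by (simp add: v_def)
    have vQ: "(\<Sum>ys\<in>words n. h ys * F (v ys)) = (\<Sum>ys | ys \<in> words n \<and> dec ys = w. h ys) * F (real M)
        + (\<Sum>ys | ys \<in> words n \<and> dec ys \<noteq> w. h ys) * F \<kappa>" for h :: "'y list \<Rightarrow> real" and F :: "real \<Rightarrow> real"
      unfolding split[of _ w] sum_distrib_right by (simp add: v_def)
    have corr: "(\<Sum>ss\<in>words n. \<Sum>ys | ys \<in> words n \<and> dec ys = w. joint_prob act inp w n ss ys) = 1 - err w"
      using sum_joint_prob[where n = n and act = act and inp = inp and w = w]
      by (simp add: split[of _ w] sum.distrib err_def)
    obtain ys0 where ys0: "ys0 \<in> words n" "Q ys0 \<noteq> 0"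
      using Q(2) by (metis sum.neutral zero_neq_one)
    then have pos: "(\<Sum>ys\<in>words n. Q ys * v ys) > 0"
      using Q(1) v by (intro sum_pos2[of _ ys0]) (auto simp: less_le)
    have "(1 - err w) * ln (real M) + err w * ln \<kappa>
        = (\<Sum>ss\<in>words n. \<Sum>ys\<in>words n. joint_prob act inp w n ss ys * ln (v ys))"
      unfolding vQ sum.distrib sum_distrib_right[symmetric] corr by (simp add: err_def)
    also have "\<dots> \<le> real n * info P + ln (\<Sum>ys\<in>words n. Q ys * v ys)"
      unfolding Q_def by (rule sum_joint_prob_ln_le[OF P v])
    \<comment> \<open>This makes the bound linear in \<open>q w\<close>, so that averaging over w
      needs only the sum of the \<open>q w\<close>.\<close>
    also have "ln (\<Sum>ys\<in>words n. Q ys * v ys) \<le> (\<Sum>ys\<in>words n. Q ys * v ys) - 1"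
      by (rule ln_le_minus_one[OF pos])
    also have "(\<Sum>ys\<in>words n. Q ys * v ys) \<le> real M * q w + \<kappa>"
    proof -
      have "(\<Sum>ys | ys \<in> words n \<and> dec ys \<noteq> w. Q ys) \<le> sum Q (words n)"
        using Q(1) by (intro sum_mono2) auto
      then show ?thesis using Q(2) \<kappa> vQ[of Q "\<lambda>x. x"] by (simp add: q_def mult_ac)
    qed
    finally show ?thesis by simp
  qed
  \<comment> \<open>The decoding regions of different messages are disjoint.\<close>
  have q: "(\<Sum>w<M. q w) \<le> 1"
  proof -
    have "(\<Sum>w<M. q w) = (\<Sum>w<M. \<Sum>ys | ys \<in> {ys \<in> words n. dec ys < M} \<and> dec ys = w. Q ys)"
      unfolding q_def by (intro sum.cong) auto
    also have "\<dots> = (\<Sum>ys | ys \<in> words n \<and> dec ys < M. Q ys)"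
      by (rule sum.group) auto
    also have "\<dots> \<le> sum Q (words n)" using Q(1) by (intro sum_mono2) auto
    finally show ?thesis by (simp add: Q)
  qed
  have e: "(\<Sum>w<M. err w) = real M * e"
    unfolding e_def error_prob_eq[OF M] err_def using M by simp
  have "(\<Sum>w<M. (1 - err w) * ln (real M) + err w * ln \<kappa>) \<le> (\<Sum>w<M. real n * info P + (real M * q w + \<kappa> - 1))"
    by (intro sum_mono w)
  also have "\<dots> = real M * (real n * info P + \<kappa> - 1) + real M * (\<Sum>w<M. q w)"
    by (simp add: sum.distrib sum_subtractf sum_distrib_left algebra_simps)
  also have "\<dots> \<le> real M * (real n * info P + \<kappa> - 1) + real M * 1"
    using q by (intro add_left_mono mult_left_mono) auto
  also have "(\<Sum>w<M. (1 - err w) * ln (real M) + err w * ln \<kappa>) = real M * ((1 - e) * ln (real M) + e * ln \<kappa>)"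
  proof -
    have "(\<Sum>w<M. (1 - err w) * ln (real M) + err w * ln \<kappa>)
        = (real M - (\<Sum>w<M. err w)) * ln (real M) + (\<Sum>w<M. err w) * ln \<kappa>"
      by (simp add: sum.distrib sum_subtractf flip: sum_distrib_right)
    then show ?thesis by (simp add: e algebra_simps)
  qed
  finally have "real M * ((1 - e) * ln (real M) + e * ln \<kappa>) \<le> real M * (real n * info P + \<kappa>)"
    by (simp add: algebra_simps)
  then show ?thesis using M by simp
qed

text \<open>After division by n the converse bound no longer mentions the code, which may vary with
  \<open>\<epsilon>\<close>. So \<open>\<epsilon>\<close> can tend to 0 for fixed
  \<open>\<kappa>\<close>, and then \<open>\<kappa>\<close> to 0.\<close>

lemma achievable_rate_le:
  assumes P: "optimal P" and R: "achievable_rate N f g R"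
  shows "R \<le> info P / ln 2"
proof -
  have bound: "(1 - \<epsilon>) * (R * ln 2) + \<epsilon> * ln \<kappa> \<le> info P + \<kappa>"
    if \<epsilon>: "0 < \<epsilon>" "\<epsilon> < 1" and \<kappa>: "0 < \<kappa>" "\<kappa> \<le> 1" for \<epsilon> \<kappa> :: real
  proof -
    obtain n M act inp dec where n: "n > 0" and M: "M > 0" and rate: "R \<le> log 2 (real M) / real n"
      and err: "error_prob N f g M n act inp dec < \<epsilon>"
      using R \<epsilon>(1) unfolding achievable_rate_def by blast
    let ?e = "error_prob N f g M n act inp dec"
    have "real n * ((1 - \<epsilon>) * (R * ln 2) + \<epsilon> * ln \<kappa>) \<le> (1 - \<epsilon>) * ln (real M) + \<epsilon> * ln \<kappa>"
    proof -
      have "(1 - \<epsilon>) * (real n * (R * ln 2)) \<le> (1 - \<epsilon>) * ln (real M)"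
        using rate n \<epsilon> by (intro mult_left_mono) (auto simp: log_def field_simps)
      \<comment> \<open>Here \<open>ln \<kappa> \<le> 0\<close> and n is at least 1.\<close>
      moreover have "real n * (\<epsilon> * ln \<kappa>) \<le> 1 * (\<epsilon> * ln \<kappa>)"
        using n \<epsilon> \<kappa> by (intro mult_right_mono_neg) (auto simp: mult_nonneg_nonpos)
      ultimately show ?thesis by (simp add: algebra_simps)
    qed
    also have "\<dots> \<le> (1 - ?e) * ln (real M) + ?e * ln \<kappa>"
      using err M \<kappa> by (intro add_mono mult_right_mono mult_right_mono_neg) auto
    also have "\<dots> \<le> real n * info P + \<kappa>" by (rule converse_bound[OF P M \<kappa>(1)])
    also have "\<dots> \<le> real n * (info P + \<kappa>)" using n \<kappa> by (simp add: distrib_left)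
    finally show ?thesis using n by simp
  qed
  have "R * ln 2 \<le> info P + \<kappa>" if \<kappa>: "0 < \<kappa>" "\<kappa> \<le> 1" for \<kappa>
  proof (rule tendsto_upperbound)
    show "((\<lambda>\<epsilon>. (1 - \<epsilon>) * (R * ln 2) + \<epsilon> * ln \<kappa>) \<longlongrightarrow> R * ln 2) (at_right 0)"
      by (auto intro!: tendsto_eq_intros)
    show "\<forall>\<^sub>F \<epsilon> in at_right 0. (1 - \<epsilon>) * (R * ln 2) + \<epsilon> * ln \<kappa> \<le> info P + \<kappa>"
      using bound \<kappa> by (intro eventually_at_rightI[of 0 1]) auto
  qed auto
  note le = this
  have "R * ln 2 \<le> info P"
  proof (rule field_le_epsilon)
    fix \<kappa> :: real assume "\<kappa> > 0"
    then show "R * ln 2 \<le> info P + \<kappa>" using le[of "min \<kappa> 1"] by simp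
  qed
  then show ?thesis by (simp add: pos_le_divide_eq)
qed

text \<open>A single message is never decoded wrongly and has rate 0.\<close>

lemma achievable_rate_nonpos:
  assumes "R \<le> 0" shows "achievable_rate N f g R"
proof -
  have "error_prob N f g 1 1 act inp (\<lambda>_. 0) = 0" for act inp
    by (simp add: error_prob_eq)
  then show ?thesis
    unfolding achievable_rate_def using assms by (metis div_by_1 less_numeral_extra(1) log_one of_nat_1)
qed

lemma achievable_rate_less:
  assumes P: "is_dist P" and R: "R < info P / ln 2" "0 \<le> R"
  shows "achievable_rate N f g R"
  unfolding achievable_rate_def
proof (intro allI impI)
  fix \<epsilon> :: real assume "\<epsilon> > 0"
  \<comment> \<open>Halving turns the non-strict error bound of \<open>ex_code\<close> into a strict
    one.\<close>
  then have \<epsilon>: "\<epsilon> / 2 > 0" by simp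
  have "0 \<le> R * ln 2" "R * ln 2 < info P" using R by (auto simp: pos_less_divide_eq)
  from ex_code[OF P this \<epsilon>] obtain n M c dec where n: "n > 0" and M: "M > 0"
    and rate: "real n * (R * ln 2) \<le> ln (real M)" and len: "\<And>w. w < M \<Longrightarrow> length (c w) = n"
    and corr: "\<And>w. w < M \<Longrightarrow> (\<Sum>ys | ys \<in> words n \<and> dec ys = w. word_channel n (c w) ys) \<ge> 1 - \<epsilon> / 2"
    by blast
  \<comment> \<open>In block i, \<open>act\<close> sees i states and \<open>inp\<close> sees i + 1,
    so both indices select letter i of the codeword. Only the current state affects the
    input.\<close>
  define act where "act w ss = fst (c w ! length ss)" for w :: nat and ss :: "'s list"
  define inp where "inp w ss = snd (c w ! (length ss - 1)) (last ss)" for w :: nat and ss :: "'s list"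
  have out: "(\<Sum>ss\<in>words n. joint_prob act inp w n ss ys) = word_channel n (c w) ys" for w ys
  proof -
    have "joint_prob act inp w n ss ys
        = (\<Prod>i<n. slot_prob (fst (c w ! i)) (ss ! i) (snd (c w ! i) (ss ! i)) (ys ! i))" if "length ss = n" for ss
      unfolding joint_prob_def
      using that by (intro prod.cong) (auto simp: act_def inp_def take_Suc_conv_app_nth)
    then have "(\<Sum>ss\<in>words n. joint_prob act inp w n ss ys)
        = (\<Sum>ss\<in>words n. \<Prod>i<n. slot_prob (fst (c w ! i)) (ss ! i) (snd (c w ! i) (ss ! i)) (ys ! i))"
      by simp
    also have "\<dots> = (\<Prod>i<n. \<Sum>s\<in>UNIV. slot_prob (fst (c w ! i)) s (snd (c w ! i) s) (ys ! i))"
      by (rule sum_words_prod)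
    also have "\<dots> = word_channel n (c w) ys"
      unfolding word_channel_def by (intro prod.cong refl) (simp flip: strategy_channel_eq_sum)
    finally show ?thesis .
  qed
  have err: "(\<Sum>ss\<in>words n. \<Sum>ys | ys \<in> words n \<and> dec ys \<noteq> w. joint_prob act inp w n ss ys) \<le> \<epsilon> / 2" if "w < M" for w
  proof -
    have "(\<Sum>ss\<in>words n. \<Sum>ys | ys \<in> words n \<and> dec ys \<noteq> w. joint_prob act inp w n ss ys)
        = (\<Sum>ys | ys \<in> words n \<and> dec ys \<noteq> w. word_channel n (c w) ys)"
      by (subst sum.swap) (simp add: out)
    moreover have "(\<Sum>ys | ys \<in> words n \<and> dec ys = w. word_channel n (c w) ys)
        + (\<Sum>ys | ys \<in> words n \<and> dec ys \<noteq> w. word_channel n (c w) ys) = (\<Sum>ys\<in>words n. word_channel n (c w) ys)"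
      by (subst sum.union_disjoint[symmetric]) (auto intro!: sum.cong)
    moreover have "(\<Sum>ys\<in>words n. word_channel n (c w) ys) = 1"
      by (simp add: word_channel_def sum_words_prod[of "\<lambda>i. strategy_channel (c w ! i)" n] W_sum)
    ultimately show ?thesis using corr[OF that] by linarith
  qed
  have "error_prob N f g M n act inp dec \<le> (\<Sum>w<M. \<epsilon> / 2) / real M"
    unfolding error_prob_eq[OF M] using err by (intro divide_right_mono sum_mono) auto
  also have "\<dots> < \<epsilon>" using M \<open>\<epsilon> > 0\<close> by simp
  finally have "error_prob N f g M n act inp dec < \<epsilon>" .
  moreover have "R \<le> log 2 (real M) / real n"
    using rate n by (simp add: log_def field_simps)
  ultimately show "\<exists>n>0. \<exists>M>0. R \<le> log 2 (real M) / real n \<and> (\<exists>act inp dec. error_prob N f g M n act inp dec < \<epsilon>)"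
    using n M by blast
qed

lemma capacity_eq:
  assumes P: "optimal P"
  shows "2 * capacity N f g = ereal (info P / ln 2)"
proof -
  have "(SUP R\<in>{R. achievable_rate N f g R}. ereal R) = ereal (info P / ln 2)"
  proof (rule antisym)
    show "(SUP R\<in>{R. achievable_rate N f g R}. ereal R) \<le> ereal (info P / ln 2)"
      using achievable_rate_le[OF P] by (intro SUP_least) auto
    show "ereal (info P / ln 2) \<le> (SUP R\<in>{R. achievable_rate N f g R}. ereal R)"
    proof (rule dense_le)
      fix r assume r: "r < ereal (info P / ln 2)"
      show "r \<le> (SUP R\<in>{R. achievable_rate N f g R}. ereal R)"
      proof (cases r)
        case (real R)
        \<comment> \<open>Nonpositive rates are treated apart because the coding lemma assumes a
          nonnegative rate.\<close>
        then have "achievable_rate N f g R"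
          using r P achievable_rate_nonpos[of R] achievable_rate_less[of P R]
          by (cases "R \<le> 0") (auto simp: optimal_def)
        then show ?thesis unfolding real by (intro SUP_upper) simp
      qed (use r in auto)
    qed
  qed
  then show ?thesis by (simp add: capacity_def slots_per_block_def)
qed

text \<open>
  The rows of the channel from \<open>(b, a)\<close> depend linearly on the indicators of \<open>b\<close> and of
  \<open>(b, s, a s)\<close>; those with \<open>a s = x0\<close> are redundant since \<open>a s\<close> takes exactly one value.
\<close>

lemma strategy_channel_factors_states:
  fixes x0 :: 'x
  defines "K \<equiv> (UNIV :: 'b set) <+> ((UNIV :: 'b set) \<times> (UNIV :: 's set) \<times> (UNIV - {x0}))"
  shows "\<exists>\<phi> \<psi>. \<forall>u y. strategy_channel u y = (\<Sum>k\<in>K. \<phi> k u * \<psi> k y)"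
proof -
  define \<phi> :: "'b + 'b \<times> 's \<times> 'x \<Rightarrow> 'b \<times> ('s \<Rightarrow> 'x) \<Rightarrow> real" where
    "\<phi> k u = (case k of Inl b \<Rightarrow> of_bool (fst u = b)
    | Inr (b, s, x) \<Rightarrow> of_bool (fst u = b \<and> snd u s = x))" for k u
  \<comment> \<open>The baseline uses \<open>x0\<close> in every state; the other terms correct it
    in the states where the strategy chooses another input.\<close>
  define \<psi> where "\<psi> k y = (case k of Inl b \<Rightarrow> \<Sum>s\<in>UNIV. slot_prob b s x0 y
    | Inr (b, s, x) \<Rightarrow> slot_prob b s x y - slot_prob b s x0 y)"
    for k :: "'b + 'b \<times> 's \<times> 'x" and y
  have "strategy_channel (b, a) y = (\<Sum>k\<in>K. \<phi> k (b, a) * \<psi> k y)" for b a y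
  proof -
    have "(\<Sum>k\<in>K. \<phi> k (b, a) * \<psi> k y) = (\<Sum>b'\<in>UNIV. of_bool (b = b') * (\<Sum>s\<in>UNIV. slot_prob b' s x0 y))
        + (\<Sum>b'\<in>UNIV. \<Sum>s\<in>UNIV. \<Sum>x\<in>UNIV - {x0}. of_bool (b = b' \<and> a s = x) * (slot_prob b' s x y - slot_prob b' s x0 y))"
    proof -
      have "sum F (UNIV \<times> UNIV \<times> (UNIV - {x0})) = (\<Sum>b'\<in>UNIV. \<Sum>s\<in>UNIV. \<Sum>x\<in>UNIV - {x0}. F (b', s, x))"
        for F :: "'b \<times> 's \<times> 'x \<Rightarrow> real"
        by (simp add: sum.cartesian_product split_beta)
      then show ?thesis unfolding K_def by (subst sum.Plus) (simp_all add: \<phi>_def \<psi>_def)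
    qed
    also have "(\<Sum>b'\<in>UNIV. of_bool (b = b') * (\<Sum>s\<in>UNIV. slot_prob b' s x0 y)) = (\<Sum>s\<in>UNIV. slot_prob b s x0 y)"
      by simp
    also have "(\<Sum>b'\<in>UNIV. \<Sum>s\<in>UNIV. \<Sum>x\<in>UNIV - {x0}. of_bool (b = b' \<and> a s = x) * (slot_prob b' s x y - slot_prob b' s x0 y))
        = (\<Sum>s\<in>UNIV. \<Sum>x\<in>UNIV - {x0}. of_bool (a s = x) * (slot_prob b s x y - slot_prob b s x0 y))"
      by (simp add: of_bool_conj mult.assoc flip: sum_distrib_left)
    also have "\<dots> = (\<Sum>s\<in>UNIV. slot_prob b s (a s) y - slot_prob b s x0 y)"
    proof (rule sum.cong[OF refl])
      fix s
      have "(UNIV - {x0}) \<inter> {a s} = (if a s = x0 then {} else {a s})" by auto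
      then show "(\<Sum>x\<in>UNIV - {x0}. of_bool (a s = x) * (slot_prob b s x y - slot_prob b s x0 y))
          = slot_prob b s (a s) y - slot_prob b s x0 y" by simp
    qed
    finally show ?thesis by (simp add: strategy_channel_eq_sum sum_subtractf)
  qed
  then show ?thesis by (metis surj_pair)
qed

end

theorem mainTheorem8:
  fixes N :: "'z measure"
    and g :: "'b::finite \<Rightarrow> 'z \<Rightarrow> 's::finite"
    and f :: "'x::finite \<Rightarrow> 's \<Rightarrow> 'z \<Rightarrow> 'y::finite"
  assumes "prob_space N"
    and "\<And>b. g b \<in> measurable N (count_space UNIV)"
    and "\<And>x s. f x s \<in> measurable N (count_space UNIV)"
  shows "\<exists>P :: ('b \<times> ('s \<Rightarrow> 'x)) pmf.
    2 * capacity N f g = ereal (block_information N f g P) \<and>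
    (\<forall>Q. block_information N f g Q \<le> block_information N f g P) \<and>
    card (set_pmf P) \<le> min CARD('y) (CARD('b) + CARD('b) * CARD('s) * (CARD('x) - 1))"
proof -
  interpret prob_space N by fact
  interpret action_state_channel N f g using assms(2,3) by unfold_locales auto
  obtain P0 where opt: "optimal P0"
    and min: "\<And>Q. optimal Q \<Longrightarrow> card {u. P0 u \<noteq> 0} \<le> card {u. Q u \<noteq> 0}"
    using ex_optimal_min_support by blast
  define P where "P = embed_pmf P0"
  have P: "pmf P = P0"
  proof
    have P0: "0 \<le> P0 u" "sum P0 UNIV = 1" for u
      using opt unfolding optimal_def is_dist_def by blast+
    then have "(\<integral>\<^sup>+u. ennreal (P0 u) \<partial>count_space UNIV) = 1"
      by (simp add: nn_integral_count_space_finite sum_ennreal)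
    then show "pmf P u = P0 u" for u
      unfolding P_def using P0 by (intro pmf_embed_pmf)
  qed
  have "block_information N f g Q \<le> block_information N f g P" for Q
  proof -
    have "is_dist (pmf Q)" by (simp add: is_dist_def sum_pmf_eq_1)
    then show ?thesis using opt by (simp add: block_information_eq P optimal_def divide_right_mono)
  qed
  \<comment> \<open>The trivial factorization, expanding each row in the indicators of the
    outputs.\<close>
  moreover have "card {u. P0 u \<noteq> 0} \<le> CARD('y)"
    by (rule min_support_le[OF opt min, of UNIV "\<lambda>k u. strategy_channel u k" "\<lambda>k y. of_bool (k = y)"]) auto
  moreover have "card {u. P0 u \<noteq> 0} \<le> CARD('b) + CARD('b) * CARD('s) * (CARD('x) - 1)"
  proof -
    \<comment> \<open>Here \<open>undefined\<close> is just some input letter in the role of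
      \<open>x0\<close>.\<close>
    let ?K = "(UNIV :: 'b set) <+> ((UNIV :: 'b set) \<times> (UNIV :: 's set) \<times> (UNIV - {undefined :: 'x}))"
    obtain \<phi> \<psi> where "\<And>u y. strategy_channel u y = (\<Sum>k\<in>?K. \<phi> k u * \<psi> k y)"
      using strategy_channel_factors_states by blast
    then have "card {u. P0 u \<noteq> 0} \<le> card ?K" by (intro min_support_le[OF opt min]) auto
    also have "\<dots> = CARD('b) + CARD('b) * CARD('s) * (CARD('x) - 1)"
      by (simp add: card_Plus card_cartesian_product card_Diff_singleton mult.assoc)
    finally show ?thesis .
  qed
  ultimately show ?thesis
    using capacity_eq[OF opt] by (intro exI[of _ P]) (simp add: block_information_eq P set_pmf_eq)
qed

end
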